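(* Let $t>0$ and $x\in\mathbb R$ be fixed, and for $c>0$ let $u_c(x,t)=\langle\dot W,\tfrac1{2c}\chi_{(x,t,c)}\rangle$ be the solution at $(x,t)$ of the one-dimensional stochastic wave equation with propagation speed $c$. The stochastic process $(v_r)_{r\ge0}$ defined by $$v_r=\frac2t\,u_{1/r}(x,t),\quad r>0,$$ with $v_0=0$, is a Brownian motion.
   Context: White noise: here $d=1$, $D=\mathbb R\times[0,\infty)$, and $\mathcal S(D)$ is the space of restrictions to $D$ of Schwartz functions on $\mathbb R^2$. The white noise probability space $(\Omega,\Sigma,P)$ is the completion of $\mathcal S'(D)$ with the weak-$\ast$ Borel $\sigma$-algebra and the unique probability measure satisfying $\int e^{i\langle\omega,\varphi\rangle}dP(\omega)=e^{-\frac12\|\varphi\|^2_{L^2(D)}}$ for all $\varphi\in\mathcal S(D)$. White noise is $\langle\dot W(\omega),\varphi\rangle=\langle\omega,\varphi|_D\rangle$; it is Gaussian with $\mathrm E\langle\dot W,\varphi\rangle=0$ and $\mathrm E(\langle\dot W,\varphi\rangle)^2=\|\varphi\|_{L^2(D)}^2$ (Itô isometry), and by this isometry $\langle\dot W,\cdot\rangle$ is extended to functions in $L^2(\mathbb R^2)$. For $(x,t)\in\mathbb R\times(0,\infty)$ and $c>0$, $\chi_{(x,t,c)}$ is the indicator function of the backward triangle with vertex $(x,t)$, i.e. the region $0\le s\le t$, $|y-x|\le c(t-s)$ in the $(y,s)$-plane. The random field solution of $(\partial_t^2-c^2\partial_x^2)u_c=\dot W$ with support in $\mathbb R\times[0,\infty)$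 is $u_c(x,t)=\langle\dot W,\tfrac1{2c}\chi_{(x,t,c)}\rangle$. As usual, a version of $u_c(x,t)$ is used for which $c\mapsto u_c(x,t,\omega)$ is continuous on $(0,\infty)$ for almost all $\omega$. *)

theory Defs
  imports "HOL-Probability.Probability"
begin

section \<open>Schwartz functions and tempered distributions on the half-plane\<close>

text \<open>Points of the plane are pairs (space, time); all test functions are real-valued.\<close>

definition half_plane :: "(real \<times> real) set" where
  "half_plane = UNIV \<times> {0..}"

definition partial_x :: "(real \<times> real \<Rightarrow> real) \<Rightarrow> real \<times> real \<Rightarrow> real" where
  "partial_x f = (\<lambda>(x, t). deriv (\<lambda>y. f (y, t)) x)"

definition partial_t :: "(real \<times> real \<Rightarrow> real) \<Rightarrow> real \<times> real \<Rightarrow> real" where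
  "partial_t f = (\<lambda>(x, t). deriv (\<lambda>s. f (x, s)) t)"

definition partials :: "nat \<Rightarrow> nat \<Rightarrow> (real \<times> real \<Rightarrow> real) \<Rightarrow> real \<times> real \<Rightarrow> real" where
  "partials i j f = (partial_x ^^ i) ((partial_t ^^ j) f)"

text \<open>Requiring every \<open>partials i j f\<close> to be (totally) differentiable is the same as requiring
  \<open>f\<close> to be smooth, because mixed partial derivatives then commute.\<close>

definition schwartz :: "(real \<times> real \<Rightarrow> real) set" where
  "schwartz = {f. \<forall>i j. partials i j f differentiable_on UNIV \<and>
                  (\<forall>k::nat. bounded (range (\<lambda>z. (1 + norm z) ^ k * partials i j f z)))}"

definition schwartz_half :: "(real \<times> real \<Rightarrow> real) set" where
  "schwartz_half = (\<lambda>f. restrict f half_plane) ` schwartz"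

text \<open>The supremum runs over the open half-plane, where the two-sided derivatives of a restricted
  function depend on its values in the half-plane only. By continuity of the derivatives of a
  Schwartz extension, the closed half-plane would give the same value.\<close>

definition half_seminorm :: "nat \<Rightarrow> nat \<Rightarrow> nat \<Rightarrow> (real \<times> real \<Rightarrow> real) \<Rightarrow> real" where
  "half_seminorm k i j \<psi> = (SUP z\<in>UNIV \<times> {0<..}. (1 + norm z) ^ k * \<bar>partials i j \<psi> z\<bar>)"

definition schwartz_half_topology :: "(real \<times> real \<Rightarrow> real) topology" where
  "schwartz_half_topology = topology_generated_by
     {{\<psi> \<in> schwartz_half. half_seminorm k i j (\<lambda>z. \<psi> z - \<phi> z) < e} | \<phi> k i j e.
        \<phi> \<in> schwartz_half \<and> e > 0}"

text \<open>Functionals are made extensional so that they are determined by their values on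
  \<^const>\<open>schwartz_half\<close>.\<close>

definition distributions_half :: "((real \<times> real \<Rightarrow> real) \<Rightarrow> real) set" where
  "distributions_half = {\<omega> \<in> extensional schwartz_half.
     (\<forall>\<phi>\<in>schwartz_half. \<forall>\<psi>\<in>schwartz_half. \<forall>a b.
        \<omega> (\<lambda>z\<in>half_plane. a * \<phi> z + b * \<psi> z) = a * \<omega> \<phi> + b * \<omega> \<psi>) \<and>
     continuous_map schwartz_half_topology euclideanreal \<omega>}"

definition weak_star_topology :: "((real \<times> real \<Rightarrow> real) \<Rightarrow> real) topology" where
  "weak_star_topology = topology_generated_by
     {{\<omega> \<in> distributions_half. \<omega> \<phi> \<in> U} | \<phi> U. \<phi> \<in> schwartz_half \<and> open U}"

definition weak_star_borel :: "((real \<times> real \<Rightarrow> real) \<Rightarrow> real) measure" where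
  "weak_star_borel = sigma distributions_half {A. openin weak_star_topology A}"


section \<open>White noise\<close>

definition square_integrable :: "'a measure \<Rightarrow> ('a \<Rightarrow> real) \<Rightarrow> bool" where
  "square_integrable M f \<longleftrightarrow> f \<in> borel_measurable M \<and> integrable M (\<lambda>x. (f x)\<^sup>2)"

definition l2_norm :: "'a measure \<Rightarrow> ('a \<Rightarrow> real) \<Rightarrow> real" where
  "l2_norm M f = sqrt (\<integral>x. (f x)\<^sup>2 \<partial>M)"

text \<open>\<open>P\<close> lives on the weak-* Borel sets; the white noise probability space itself is
  \<open>completion P\<close>.\<close>

definition white_noise_measure :: "((real \<times> real \<Rightarrow> real) \<Rightarrow> real) measure \<Rightarrow> bool" where
  "white_noise_measure P \<longleftrightarrow>
     prob_space P \<and> space P = distributions_half \<and> sets P = sets weak_star_borel \<and>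
     (\<forall>\<phi>\<in>schwartz_half. (\<integral>\<omega>. exp (\<i> * complex_of_real (\<omega> \<phi>)) \<partial>P)
        = complex_of_real (exp (- (1 / 2) * (l2_norm (lebesgue_on half_plane) \<phi>)\<^sup>2)))"

definition white_noise ::
    "((real \<times> real \<Rightarrow> real) \<Rightarrow> real) \<Rightarrow> (real \<times> real \<Rightarrow> real) \<Rightarrow> real" where
  "white_noise \<omega> \<phi> = \<omega> (restrict \<phi> half_plane)"

text \<open>\<open>X\<close> is a version of the white noise applied to \<open>f\<close>, where white noise is extended from
  Schwartz functions to square-integrable functions by means of the Ito isometry: \<open>X\<close> is the limit
  in mean square of the white noise at Schwartz functions approximating \<open>f\<close>. Only the restriction
  of \<open>f\<close> to the half-plane matters, hence the norm used for the approximation.\<close>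

definition white_noise_version ::
    "((real \<times> real \<Rightarrow> real) \<Rightarrow> real) measure \<Rightarrow> (real \<times> real \<Rightarrow> real) \<Rightarrow>
     (((real \<times> real \<Rightarrow> real) \<Rightarrow> real) \<Rightarrow> real) \<Rightarrow> bool" where
  "white_noise_version P f X \<longleftrightarrow>
     square_integrable lebesgue f \<and> square_integrable (completion P) X \<and>
     (\<exists>\<phi>. (\<forall>n::nat. \<phi> n \<in> schwartz) \<and>
        (\<lambda>n. l2_norm (lebesgue_on half_plane) (\<lambda>z. \<phi> n z - f z)) \<longlonglongrightarrow> 0 \<and>
        (\<lambda>n. l2_norm (completion P) (\<lambda>\<omega>. white_noise \<omega> (\<phi> n) - X \<omega>)) \<longlonglongrightarrow> 0)"

definition backward_triangle :: "real \<Rightarrow> real \<Rightarrow> real \<Rightarrow> (real \<times> real) set" where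
  "backward_triangle x t c = {(y, s). 0 \<le> s \<and> s \<le> t \<and> \<bar>y - x\<bar> \<le> c * (t - s)}"


section \<open>Brownian motion\<close>

definition brownian_motion :: "'a measure \<Rightarrow> (real \<Rightarrow> 'a \<Rightarrow> real) \<Rightarrow> bool" where
  "brownian_motion M B \<longleftrightarrow>
     prob_space M \<and>
     (\<forall>r\<ge>0. B r \<in> borel_measurable M) \<and>
     (AE \<omega> in M. B 0 \<omega> = 0) \<and>
     (\<forall>(\<tau> :: nat \<Rightarrow> real) n. 0 \<le> \<tau> 0 \<and> (\<forall>i<n. \<tau> i < \<tau> (Suc i)) \<longrightarrow>
        prob_space.indep_vars M (\<lambda>_. borel) (\<lambda>i \<omega>. B (\<tau> (Suc i)) \<omega> - B (\<tau> i) \<omega>) {..<n}) \<and>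
     (\<forall>r s. 0 \<le> r \<and> r < s \<longrightarrow>
        distributed M lborel (\<lambda>\<omega>. B s \<omega> - B r \<omega>) (normal_density 0 (sqrt (s - r)))) \<and>
     (AE \<omega> in M. continuous_on {0..} (\<lambda>r. B r \<omega>))"

end

theory Submission
  imports Defs
begin

text \<open>
  The Ito isometry turns the statement into the computation of one inner product. For \<open>r > 0\<close> the
  variable \<open>v\<^sub>r\<close> is white noise applied to \<open>g\<^sub>r = (r / t) \<chi>\<close>, where \<open>\<chi>\<close> is the indicator of the
  backward triangle of speed \<open>1 / r\<close>; put \<open>g\<^sub>0 = 0\<close>. Backward triangles with the same vertex are
  nested, and the one of speed \<open>c\<close> has area \<open>c t\<^sup>2\<close>, so
  \<open>\<langle>g\<^sub>r, g\<^sub>s\<rangle> = (r s / t\<^sup>2) min (1/r) (1/s) t\<^sup>2 = min r s\<close>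
  (\<open>integral_normalized_triangle_product\<close>), the covariance of Brownian motion. Consequently the
  increments of \<open>r \<mapsto> g\<^sub>r\<close> over successive intervals are orthogonal, with squared norms
  the lengths of the intervals.

  The passage from orthogonality to independence and normality goes through characteristic functions.
  Versions of white noise depend linearly on the integrand (\<open>white_noise_version_linear\<close>), and the formula
  \<open>E exp(i W(f)) = exp(- \<parallel>f\<parallel>\<^sup>2 / 2)\<close> survives the mean-square limit that
  defines them (\<open>white_noise_version_char\<close>). Applied to a linear combination of orthogonal integrands, it
  says that the joint characteristic function is a product, and this forces independence
  (\<open>indep_vars_of_char_factorization\<close>).

  Continuity of the paths on the open half-line is inherited from \<open>c \<mapsto> u\<^sub>c\<close>, but \<open>r \<rightarrow> 0\<close> corresponds
  to \<open>c \<rightarrow> \<infinity>\<close>, about which the hypotheses say nothing. There the maximal inequality of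
  Kolmogorov, applied to the increments over ever finer grids in \<open>[0, \<delta>]\<close>, bounds the probability that
  the path leaves \<open>[-\<epsilon>, \<epsilon>]\<close> before time \<open>\<delta>\<close> by \<open>\<delta> / \<epsilon>\<^sup>2\<close>, so that almost surely the path tends to
  its value \<open>0\<close> (\<open>AE_continuous_at_zero\<close>).
\<close>

section \<open>Mean-square norms\<close>

lemma square_integrable_integrable_mult:
  assumes "square_integrable M f" "square_integrable M g"
  shows "integrable M (\<lambda>z. f z * g z)"
proof (rule Bochner_Integration.integrable_bound)
  show "integrable M (\<lambda>z. (f z)\<^sup>2 + (g z)\<^sup>2)"
    using assms by (auto simp: square_integrable_def)
  show "(\<lambda>z. f z * g z) \<in> borel_measurable M"
    using assms by (auto simp: square_integrable_def)
  show "AE z in M. norm (f z * g z) \<le> norm ((f z)\<^sup>2 + (g z)\<^sup>2)"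
  proof (rule AE_I2)
    fix z
    have "\<bar>f z\<bar> * \<bar>g z\<bar> \<le> \<bar>f z\<bar>\<^sup>2 + \<bar>g z\<bar>\<^sup>2"
      using sum_squares_bound[of "\<bar>f z\<bar>" "\<bar>g z\<bar>"] mult_nonneg_nonneg[of "\<bar>f z\<bar>" "\<bar>g z\<bar>"] by linarith
    then show "norm (f z * g z) \<le> norm ((f z)\<^sup>2 + (g z)\<^sup>2)"
      by (simp add: abs_mult)
  qed
qed

lemma square_integrable_linear:
  assumes "square_integrable M f" "square_integrable M g"
  shows "square_integrable M (\<lambda>z. a * f z + b * g z)"
proof -
  have "integrable M (\<lambda>z. a\<^sup>2 * (f z)\<^sup>2 + b\<^sup>2 * (g z)\<^sup>2 + 2 * a * b * (f z * g z))"
    using assms square_integrable_integrable_mult[OF assms]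
    by (auto simp: square_integrable_def)
  then have "integrable M (\<lambda>z. (a * f z + b * g z)\<^sup>2)"
    by (simp add: power2_eq_square algebra_simps)
  then show ?thesis
    using assms by (auto simp: square_integrable_def)
qed

lemma square_integrable_diff:
  "square_integrable M f \<Longrightarrow> square_integrable M g \<Longrightarrow> square_integrable M (\<lambda>z. f z - g z)"
  using square_integrable_linear[of M f g 1 "-1"] by simp

lemma square_integrable_sum:
  assumes "\<And>i. i \<in> I \<Longrightarrow> square_integrable M (f i)"
  shows "square_integrable M (\<lambda>z. \<Sum>i\<in>I. f i z)"
  using assms
proof (induction I rule: infinite_finite_induct)
  case (insert i I)
  then show ?case
    using square_integrable_linear[of M "f i" "\<lambda>z. \<Sum>i\<in>I. f i z" 1 1] by simp
qed (simp_all add: square_integrable_def)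

lemma l2_norm_nonneg: "0 \<le> l2_norm M f"
  by (simp add: l2_norm_def)

lemma l2_norm_squared: "(l2_norm M f)\<^sup>2 = (\<integral>z. (f z)\<^sup>2 \<partial>M)"
  by (simp add: l2_norm_def)

lemma l2_norm_scale: "l2_norm M (\<lambda>z. a * f z) = \<bar>a\<bar> * l2_norm M f"
  by (simp add: l2_norm_def power_mult_distrib real_sqrt_mult)

text \<open>The Cauchy-Schwarz inequality: the quadratic polynomial
  \<open>s \<mapsto> \<integral> (f - s g)\<^sup>2\<close> is nonnegative, so its discriminant is not positive.\<close>

lemma integral_mult_le_l2_norm:
  assumes f: "square_integrable M f" and g: "square_integrable M g"
  shows "\<bar>\<integral>z. f z * g z \<partial>M\<bar> \<le> l2_norm M f * l2_norm M g"
proof -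
  define A where "A = (\<integral>z. (f z)\<^sup>2 \<partial>M)"
  define B where "B = (\<integral>z. (g z)\<^sup>2 \<partial>M)"
  define C where "C = (\<integral>z. f z * g z \<partial>M)"
  have int: "integrable M (\<lambda>z. (f z)\<^sup>2)" "integrable M (\<lambda>z. (g z)\<^sup>2)"
    "integrable M (\<lambda>z. f z * g z)"
    using f g square_integrable_integrable_mult[OF f g] by (auto simp: square_integrable_def)
  have poly: "0 \<le> A - 2 * s * C + s\<^sup>2 * B" for s
  proof -
    have "0 \<le> (\<integral>z. (f z - s * g z)\<^sup>2 \<partial>M)"
      by simp
    also have "\<dots> = (\<integral>z. (f z)\<^sup>2 - 2 * s * (f z * g z) + s\<^sup>2 * (g z)\<^sup>2 \<partial>M)"
      by (simp add: power2_eq_square algebra_simps)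
    also have "\<dots> = A - 2 * s * C + s\<^sup>2 * B"
      unfolding A_def B_def C_def using int by simp
    finally show ?thesis .
  qed
  have "C\<^sup>2 \<le> A * B"
  proof (cases "B = 0")
    case True
    have "C = 0"
    proof (rule ccontr)
      assume "C \<noteq> 0"
      \<comment> \<open>the polynomial is affine in \<open>s\<close> and takes the value \<open>-1\<close> at the chosen point\<close>
      then show False
        using poly[of "(A + 1) / (2 * C)"] True by (simp add: field_simps)
    qed
    with True show ?thesis by simp
  next
    case False
    then have B: "B > 0"
      by (simp add: B_def order_less_le)
    have "A - 2 * (C / B) * C + (C / B)\<^sup>2 * B = A - C\<^sup>2 / B"
      using B by (simp add: power2_eq_square field_simps)
    with poly[of "C / B"] have "C\<^sup>2 / B \<le> A"
      by simp
    then show ?thesis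
      using B by (simp add: field_simps)
  qed
  then have "sqrt (C\<^sup>2) \<le> sqrt (A * B)"
    by (rule real_sqrt_le_mono)
  then show ?thesis
    by (simp add: l2_norm_def A_def B_def C_def real_sqrt_mult)
qed

lemma l2_norm_triangle:
  assumes f: "square_integrable M f" and g: "square_integrable M g"
  shows "l2_norm M (\<lambda>z. f z + g z) \<le> l2_norm M f + l2_norm M g"
proof (rule power2_le_imp_le)
  have int: "integrable M (\<lambda>z. (f z)\<^sup>2)" "integrable M (\<lambda>z. (g z)\<^sup>2)"
    "integrable M (\<lambda>z. f z * g z)"
    using f g square_integrable_integrable_mult[OF f g] by (auto simp: square_integrable_def)
  have "(l2_norm M (\<lambda>z. f z + g z))\<^sup>2 = (\<integral>z. (f z)\<^sup>2 + (g z)\<^sup>2 + 2 * (f z * g z) \<partial>M)"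
    unfolding l2_norm_squared by (simp add: power2_eq_square algebra_simps)
  also have "\<dots> = (l2_norm M f)\<^sup>2 + (l2_norm M g)\<^sup>2 + 2 * (\<integral>z. f z * g z \<partial>M)"
    unfolding l2_norm_squared using int by simp
  also have "\<dots> \<le> (l2_norm M f)\<^sup>2 + (l2_norm M g)\<^sup>2 + 2 * (l2_norm M f * l2_norm M g)"
    using integral_mult_le_l2_norm[OF f g] by linarith
  also have "\<dots> = (l2_norm M f + l2_norm M g)\<^sup>2"
    by (simp add: power2_eq_square algebra_simps)
  finally show "(l2_norm M (\<lambda>z. f z + g z))\<^sup>2 \<le> (l2_norm M f + l2_norm M g)\<^sup>2" .
qed (simp add: l2_norm_nonneg)

lemma l2_norm_minus_commute: "l2_norm M (\<lambda>z. f z - g z) = l2_norm M (\<lambda>z. g z - f z)"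
  by (simp add: l2_norm_def power2_commute)

lemma l2_norm_triangle_reverse:
  assumes f: "square_integrable M f" and g: "square_integrable M g"
  shows "\<bar>l2_norm M f - l2_norm M g\<bar> \<le> l2_norm M (\<lambda>z. f z - g z)"
  using l2_norm_triangle[OF square_integrable_diff[OF f g] g]
    l2_norm_triangle[OF square_integrable_diff[OF g f] f]
    l2_norm_minus_commute[of M f g] by simp

lemma tendsto_l2_norm:
  assumes "\<And>n. square_integrable M (f n)" "square_integrable M g"
    and "(\<lambda>n. l2_norm M (\<lambda>z. f n z - g z)) \<longlonglongrightarrow> 0"
  shows "(\<lambda>n. l2_norm M (f n)) \<longlonglongrightarrow> l2_norm M g"
proof (rule Lim_transform2[OF tendsto_const], rule Lim_null_comparison[OF _ assms(3)])
  show "\<forall>\<^sub>F n in sequentially. norm (l2_norm M g - l2_norm M (f n)) \<le> l2_norm M (\<lambda>z. f n z - g z)"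
    using l2_norm_triangle_reverse[OF assms(1,2)] by (simp add: abs_minus_commute)
qed

lemma tendsto_l2_norm_linear:
  assumes f: "\<And>n. square_integrable M (f n)" "square_integrable M F"
      "(\<lambda>n. l2_norm M (\<lambda>z. f n z - F z)) \<longlonglongrightarrow> 0"
    and g: "\<And>n. square_integrable M (g n)" "square_integrable M G"
      "(\<lambda>n. l2_norm M (\<lambda>z. g n z - G z)) \<longlonglongrightarrow> 0"
  shows "(\<lambda>n. l2_norm M (\<lambda>z. (a * f n z + b * g n z) - (a * F z + b * G z))) \<longlonglongrightarrow> 0"
proof (rule tendsto_sandwich[OF _ _ tendsto_const])
  show "(\<lambda>n. \<bar>a\<bar> * l2_norm M (\<lambda>z. f n z - F z) + \<bar>b\<bar> * l2_norm M (\<lambda>z. g n z - G z)) \<longlonglongrightarrow> 0"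
    using tendsto_add[OF tendsto_mult_left[OF f(3), of "\<bar>a\<bar>"] tendsto_mult_left[OF g(3), of "\<bar>b\<bar>"]]
    by simp
  show "\<forall>\<^sub>F n in sequentially. 0 \<le> l2_norm M (\<lambda>z. (a * f n z + b * g n z) - (a * F z + b * G z))"
    by (simp add: l2_norm_nonneg)
  have "l2_norm M (\<lambda>z. (a * f n z + b * g n z) - (a * F z + b * G z))
      \<le> \<bar>a\<bar> * l2_norm M (\<lambda>z. f n z - F z) + \<bar>b\<bar> * l2_norm M (\<lambda>z. g n z - G z)" for n
  proof -
    have sq: "square_integrable M (\<lambda>z. a * (f n z - F z))" "square_integrable M (\<lambda>z. b * (g n z - G z))"
      using square_integrable_linear[OF square_integrable_diff[OF f(1)[of n] f(2)] f(2), of a 0]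
        square_integrable_linear[OF square_integrable_diff[OF g(1)[of n] g(2)] g(2), of b 0] by simp_all
    have "(\<lambda>z. (a * f n z + b * g n z) - (a * F z + b * G z))
        = (\<lambda>z. a * (f n z - F z) + b * (g n z - G z))"
      by (simp add: algebra_simps)
    then show ?thesis
      using l2_norm_triangle[OF sq] by (simp add: l2_norm_scale)
  qed
  then show "\<forall>\<^sub>F n in sequentially. l2_norm M (\<lambda>z. (a * f n z + b * g n z) - (a * F z + b * G z))
      \<le> \<bar>a\<bar> * l2_norm M (\<lambda>z. f n z - F z) + \<bar>b\<bar> * l2_norm M (\<lambda>z. g n z - G z)"
    by simp
qed

lemma (in prob_space) expectation_abs_le_l2_norm:
  assumes "square_integrable M f"
  shows "expectation (\<lambda>\<omega>. \<bar>f \<omega>\<bar>) \<le> l2_norm M f"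
proof -
  have "square_integrable M (\<lambda>\<omega>. \<bar>f \<omega>\<bar>)" "square_integrable M (\<lambda>_. 1)"
    using assms by (auto simp: square_integrable_def)
  from integral_mult_le_l2_norm[OF this] show ?thesis
    by (simp add: l2_norm_def prob_space)
qed

section \<open>Schwartz functions\<close>

lemma partials_0_0 [simp]: "partials 0 0 f = f"
  by (simp add: partials_def)

lemma partials_Suc_left: "partials (Suc i) j f = partial_x (partials i j f)"
  by (simp add: partials_def)

lemma partials_Suc_right: "partials 0 (Suc j) f = partial_t (partials 0 j f)"
  by (simp add: partials_def)

lemma partial_x_linear:
  assumes f: "f differentiable_on UNIV" and g: "g differentiable_on UNIV"
  shows "partial_x (\<lambda>z. a * f z + b * g z) = (\<lambda>z. a * partial_x f z + b * partial_x g z)"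
proof
  fix z :: "real \<times> real"
  obtain x t where z: "z = (x, t)" by fastforce
  have *: "((\<lambda>y. h (y, t)) has_real_derivative deriv (\<lambda>y. h (y, t)) x) (at x)"
    if "h differentiable_on UNIV" for h :: "real \<times> real \<Rightarrow> real"
  proof -
    have "h differentiable at (x, t)"
      using that by (simp add: differentiable_on_def)
    moreover have "(\<lambda>y. (y, t)) differentiable at x"
      by (auto simp: differentiable_def intro!: exI[of _ "\<lambda>y. (y, 0)"] derivative_eq_intros)
    ultimately have "(\<lambda>y. h (y, t)) differentiable at x"
      using differentiable_chain_at[of "\<lambda>y. (y, t)" x h] by (simp add: o_def)
    then show ?thesis
      by (simp add: DERIV_deriv_iff_real_differentiable)
  qed
  have "((\<lambda>y. a * f (y, t) + b * g (y, t)) has_real_derivative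
      a * deriv (\<lambda>y. f (y, t)) x + b * deriv (\<lambda>y. g (y, t)) x) (at x)"
    by (intro DERIV_add DERIV_cmult * f g)
  then show "partial_x (\<lambda>z. a * f z + b * g z) z = a * partial_x f z + b * partial_x g z"
    by (simp add: partial_x_def z DERIV_imp_deriv)
qed

lemma partial_t_eq_partial_x_swap: "partial_t f = partial_x (f \<circ> prod.swap) \<circ> prod.swap"
  by (auto simp: partial_t_def partial_x_def fun_eq_iff)

lemma partial_t_linear:
  assumes f: "f differentiable_on UNIV" and g: "g differentiable_on UNIV"
  shows "partial_t (\<lambda>z. a * f z + b * g z) = (\<lambda>z. a * partial_t f z + b * partial_t g z)"
proof -
  have swap: "(h \<circ> prod.swap) differentiable_on UNIV" if "h differentiable_on UNIV"
    for h :: "real \<times> real \<Rightarrow> real"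
  proof -
    have "(prod.swap :: real \<times> real \<Rightarrow> _) differentiable at z" for z
      unfolding prod.swap_def differentiable_def
      by (auto intro!: exI[of _ "\<lambda>y. (snd y, fst y)"] derivative_eq_intros)
    then show ?thesis
      using that differentiable_chain_at[of prod.swap _ h] by (auto simp: differentiable_on_def)
  qed
  show ?thesis
    using partial_x_linear[OF swap[OF f] swap[OF g], of a b]
    by (auto simp: partial_t_eq_partial_x_swap fun_eq_iff o_def)
qed

lemma schwartz_partials_differentiable: "f \<in> schwartz \<Longrightarrow> partials i j f differentiable_on UNIV"
  by (simp add: schwartz_def)

lemma partials_linear:
  assumes f: "f \<in> schwartz" and g: "g \<in> schwartz"
  shows "partials i j (\<lambda>z. a * f z + b * g z) = (\<lambda>z. a * partials i j f z + b * partials i j g z)"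
proof (induction i)
  case 0
  show ?case
  proof (induction j)
    case (Suc j)
    then show ?case
      using partial_t_linear[OF schwartz_partials_differentiable[OF f] schwartz_partials_differentiable[OF g]]
      by (simp add: partials_Suc_right)
  qed simp
next
  case (Suc i)
  then show ?case
    using partial_x_linear[OF schwartz_partials_differentiable[OF f] schwartz_partials_differentiable[OF g]]
    by (simp add: partials_Suc_left)
qed

lemma schwartz_linear:
  assumes f: "f \<in> schwartz" and g: "g \<in> schwartz"
  shows "(\<lambda>z. a * f z + b * g z) \<in> schwartz"
proof -
  have "bounded (range (\<lambda>z. (1 + norm z) ^ k * (a * partials i j f z + b * partials i j g z)))" for i j k
  proof -
    have "bounded (range (\<lambda>z. (1 + norm z) ^ k * partials i j f z))"
      "bounded (range (\<lambda>z. (1 + norm z) ^ k * partials i j g z))"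
      using f g by (auto simp: schwartz_def)
    then have "bounded (range (\<lambda>z. a *\<^sub>R ((1 + norm z) ^ k * partials i j f z)
        + b *\<^sub>R ((1 + norm z) ^ k * partials i j g z)))"
      by (intro bounded_plus_comp bounded_scaleR_comp)
    then show ?thesis
      by (simp add: algebra_simps)
  qed
  then show ?thesis
    using schwartz_partials_differentiable[OF f] schwartz_partials_differentiable[OF g]
    by (auto simp: schwartz_def partials_linear[OF f g] intro!: derivative_intros)
qed

lemma zero_in_schwartz: "(\<lambda>_. 0) \<in> schwartz"
proof -
  have "partials i j (\<lambda>_. 0) = (\<lambda>_. 0)" for i j
  proof (induction i)
    case 0
    show ?case
      by (induction j) (auto simp: partials_Suc_right partial_t_def)
  qed (auto simp: partials_Suc_left partial_x_def)
  then show ?thesis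
    by (auto simp: schwartz_def intro: boundedI[of _ 0])
qed

lemma lborel_integrable_inverse_one_plus_square: "integrable lborel (\<lambda>x::real. inverse (1 + x\<^sup>2))"
proof -
  have "einterval (- \<infinity>) \<infinity> = (UNIV :: real set)"
    by (auto simp: einterval_def)
  then show ?thesis
    using integrable_inverse_1_plus_square by (simp add: set_integrable_def)
qed

text \<open>Two powers of decay suffice for square integrability in the plane, as
  \<open>(1 + \<bar>z\<bar>)\<^sup>4 \<ge> (1 + x\<^sup>2) (1 + y\<^sup>2)\<close> for \<open>z = (x, y)\<close>.\<close>

lemma schwartz_square_integrable:
  assumes f: "f \<in> schwartz"
  shows "square_integrable lborel f"
proof -
  have "continuous_on UNIV f"
    using schwartz_partials_differentiable[OF f, of 0 0] by (simp add: differentiable_imp_continuous_on)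
  then have meas [measurable]: "f \<in> borel_measurable borel"
    by (rule borel_measurable_continuous_onI)
  have "bounded (range (\<lambda>z. (1 + norm z) ^ 2 * partials 0 0 f z))"
    using f unfolding schwartz_def by blast
  then obtain C where C: "\<And>z. \<bar>(1 + norm z)\<^sup>2 * f z\<bar> \<le> C"
    by (auto simp: bounded_iff)
  let ?g = "\<lambda>z::real \<times> real. inverse (1 + (fst z)\<^sup>2) * inverse (1 + (snd z)\<^sup>2)"
  have "integrable (lborel \<Otimes>\<^sub>M lborel) ?g"
  proof (rule lborel_pair.Fubini_integrable)
    show "?g \<in> borel_measurable (lborel \<Otimes>\<^sub>M lborel)" by measurable
    show "integrable lborel (\<lambda>x. \<integral>y. norm (?g (x, y)) \<partial>lborel)"
      using lborel_integrable_inverse_one_plus_square by (simp add: abs_mult)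
    show "AE x in lborel. integrable lborel (\<lambda>y. ?g (x, y))"
      using lborel_integrable_inverse_one_plus_square by simp
  qed
  then have "integrable lborel (\<lambda>z. C\<^sup>2 * ?g z)"
    by (simp add: lborel_prod)
  then have "integrable lborel (\<lambda>z. (f z)\<^sup>2)"
  proof (rule Bochner_Integration.integrable_bound)
    show "AE z in lborel. norm ((f z)\<^sup>2) \<le> norm (C\<^sup>2 * ?g z)"
    proof (rule AE_I2)
      fix z :: "real \<times> real"
      obtain x y where z: "z = (x, y)" by fastforce
      have "1 + x\<^sup>2 + y\<^sup>2 \<le> (1 + norm z)\<^sup>2"
        by (simp add: z norm_Pair power2_sum)
      then have "(1 + x\<^sup>2 + y\<^sup>2)\<^sup>2 \<le> ((1 + norm z)\<^sup>2)\<^sup>2"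
        by (rule power_mono) simp
      moreover have "(1 + x\<^sup>2) * (1 + y\<^sup>2) \<le> (1 + x\<^sup>2 + y\<^sup>2)\<^sup>2"
      proof -
        have "(1 + x\<^sup>2 + y\<^sup>2)\<^sup>2 = (1 + x\<^sup>2) * (1 + y\<^sup>2) + (x\<^sup>2 + y\<^sup>2 + x\<^sup>2 * y\<^sup>2 + (x\<^sup>2)\<^sup>2 + (y\<^sup>2)\<^sup>2)"
          by algebra
        then show ?thesis by simp
      qed
      ultimately have "(1 + x\<^sup>2) * (1 + y\<^sup>2) * (f z)\<^sup>2 \<le> ((1 + norm z)\<^sup>2)\<^sup>2 * (f z)\<^sup>2"
        by (intro mult_right_mono) auto
      also have "\<dots> = \<bar>(1 + norm z)\<^sup>2 * f z\<bar>\<^sup>2"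
        by (simp add: power_mult_distrib)
      also have "\<dots> \<le> C\<^sup>2"
        by (rule power_mono[OF C]) simp
      finally have "(1 + x\<^sup>2) * (1 + y\<^sup>2) * (f z)\<^sup>2 \<le> C\<^sup>2" .
      moreover have "0 < (1 + x\<^sup>2) * (1 + y\<^sup>2)"
        by (intro mult_pos_pos add_pos_nonneg) auto
      ultimately have "(f z)\<^sup>2 \<le> C\<^sup>2 / ((1 + x\<^sup>2) * (1 + y\<^sup>2))"
        by (simp add: pos_le_divide_eq mult.commute)
      then show "norm ((f z)\<^sup>2) \<le> norm (C\<^sup>2 * ?g z)"
        by (simp add: z divide_inverse abs_mult)
    qed
  qed simp
  then show ?thesis
    by (simp add: square_integrable_def)
qed

lemma half_plane_sets: "half_plane \<in> sets lebesgue"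
proof -
  have "closed half_plane"
    unfolding half_plane_def by (intro closed_Times) auto
  then show ?thesis by auto
qed

lemma square_integrable_half_plane:
  assumes "square_integrable lebesgue f"
  shows "square_integrable (lebesgue_on half_plane) f"
  using assms half_plane_sets integrable_mult_indicator[OF half_plane_sets, of "\<lambda>z. (f z)\<^sup>2"]
  by (auto simp: square_integrable_def integrable_restrict_space intro: measurable_restrict_space1)

lemma schwartz_square_integrable_half_plane:
  assumes "f \<in> schwartz"
  shows "square_integrable (lebesgue_on half_plane) f"
proof (rule square_integrable_half_plane)
  show "square_integrable lebesgue f"
    using schwartz_square_integrable[OF assms]
    by (auto simp: square_integrable_def integrable_completion intro: measurable_completion)
qed

section \<open>Characteristic functions, normality and independence\<close>

lemma (in prob_space) char_distr_eq:
  assumes [measurable]: "X \<in> borel_measurable M"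
  shows "char (distr M borel X) s = (CLINT \<omega>|M. iexp (s * X \<omega>))"
  by (simp add: char_def integral_distr)

lemma (in prob_space) integrable_iexp_mult:
  fixes Z :: "'a \<Rightarrow> complex"
  assumes [measurable]: "X \<in> borel_measurable M" "Z \<in> borel_measurable M"
    and "\<And>\<omega>. \<omega> \<in> space M \<Longrightarrow> norm (Z \<omega>) \<le> 1"
  shows "integrable M (\<lambda>\<omega>. iexp (X \<omega>) * Z \<omega>)"
  by (rule integrable_const_bound[of _ 1]) (use assms in \<open>auto simp: norm_mult\<close>)

text \<open>Reweighting the probability measure by a positive multiple of \<open>2 + Z\<close>, which is at least \<open>1\<close> before
  normalization, leaves the characteristic function of \<open>X\<close> unchanged by assumption. By Levy's uniqueness
  theorem it leaves the law of \<open>X\<close> unchanged, and the conclusion compares the probabilities of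
  \<open>X \<in> A\<close> under the two measures.\<close>

lemma (in prob_space) real_factorization_of_char_factorization:
  fixes Z :: "'a \<Rightarrow> real"
  assumes X [measurable]: "X \<in> borel_measurable M" and Z [measurable]: "Z \<in> borel_measurable M"
    and bound: "\<And>\<omega>. \<omega> \<in> space M \<Longrightarrow> \<bar>Z \<omega>\<bar> \<le> 1"
    and factor: "\<And>s. (CLINT \<omega>|M. iexp (s * X \<omega>) * complex_of_real (Z \<omega>))
      = (CLINT \<omega>|M. iexp (s * X \<omega>)) * complex_of_real (expectation Z)"
    and A [measurable]: "A \<in> sets borel"
  shows "expectation (\<lambda>\<omega>. indicator A (X \<omega>) * Z \<omega>) = expectation (\<lambda>\<omega>. indicator A (X \<omega>)) * expectation Z"
proof -
  define m where "m = 2 + expectation Z"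
  define w where "w \<omega> = (2 + Z \<omega>) / m" for \<omega>
  define N where "N = density M (\<lambda>\<omega>. ennreal (w \<omega>))"
  have [simp]: "integrable M Z"
    using bound by (intro integrable_const_bound[of _ 1]) auto
  have "expectation (\<lambda>_. -1) \<le> expectation Z"
    using bound by (intro integral_mono) (auto simp: abs_le_iff)
  then have m: "m > 0"
    by (simp add: m_def prob_space)
  have [measurable]: "w \<in> borel_measurable M"
    by (simp add: w_def[abs_def])
  have w_nonneg: "AE \<omega> in M. 0 \<le> w \<omega>"
    using bound m by (intro AE_I2) (force simp: w_def abs_le_iff)
  have "expectation w = 1"
    using m by (simp add: w_def[abs_def] m_def prob_space)
  moreover have "integrable M w"
    by (simp add: w_def[abs_def])
  ultimately have "(\<integral>\<^sup>+ \<omega>. ennreal (w \<omega>) \<partial>M) = 1"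
    using w_nonneg by (simp add: nn_integral_eq_integral)
  then interpret N: prob_space N
    by (intro prob_spaceI) (simp add: N_def emeasure_density cong: nn_integral_cong)
  have [measurable]: "X \<in> borel_measurable N"
    by (simp add: N_def)
  have char_eq: "char (distr N borel X) = char (distr M borel X)"
  proof
    fix s
    have i1: "integrable M (\<lambda>\<omega>. iexp (s * X \<omega>))" "integrable M (\<lambda>\<omega>. iexp (s * X \<omega>) * complex_of_real (Z \<omega>))"
      using integrable_iexp_mult[of "\<lambda>\<omega>. s * X \<omega>" "\<lambda>_. 1"]
        integrable_iexp_mult[of "\<lambda>\<omega>. s * X \<omega>" "\<lambda>\<omega>. complex_of_real (Z \<omega>)"] bound by auto
    have "char (distr N borel X) s = (CLINT \<omega>|N. iexp (s * X \<omega>))"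
      by (rule N.char_distr_eq) simp
    also have "\<dots> = (CLINT \<omega>|M. w \<omega> *\<^sub>R iexp (s * X \<omega>))"
      unfolding N_def using w_nonneg by (intro integral_density) auto
    also have "\<dots> = (CLINT \<omega>|M. (2 * iexp (s * X \<omega>) + iexp (s * X \<omega>) * complex_of_real (Z \<omega>)) / complex_of_real m)"
      by (intro Bochner_Integration.integral_cong refl)
        (simp add: w_def scaleR_conv_of_real add_divide_distrib algebra_simps)
    also have "\<dots> = (2 * (CLINT \<omega>|M. iexp (s * X \<omega>)) + (CLINT \<omega>|M. iexp (s * X \<omega>) * complex_of_real (Z \<omega>)))
        / complex_of_real m"
      using i1 by simp
    also have "\<dots> = (CLINT \<omega>|M. iexp (s * X \<omega>)) * (complex_of_real m / complex_of_real m)"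
    proof -
      have "(2 * e + e * complex_of_real z) / c = e * (complex_of_real (2 + z) / c)" for e c z
        by (simp add: algebra_simps add_divide_distrib)
      then show ?thesis
        unfolding factor m_def .
    qed
    also have "\<dots> = char (distr M borel X) s"
      using m unfolding char_distr_eq[OF X] by simp
    finally show "char (distr N borel X) s = char (distr M borel X) s" .
  qed
  have "distr N borel X = distr M borel X"
    by (rule Levy_uniqueness[OF N.real_distribution_distr real_distribution_distr char_eq]) auto
  then have "(LINT x|distr N borel X. indicat_real A x) = (LINT x|distr M borel X. indicat_real A x)"
    by simp
  then have "(LINT \<omega>|N. indicat_real A (X \<omega>)) = expectation (\<lambda>\<omega>. indicat_real A (X \<omega>))"
    by (subst (asm) (1 2) integral_distr) auto
  also have "(LINT \<omega>|N. indicat_real A (X \<omega>)) = expectation (\<lambda>\<omega>. w \<omega> *\<^sub>R indicat_real A (X \<omega>))"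
    unfolding N_def using w_nonneg by (intro integral_density) auto
  also have "\<dots> = expectation (\<lambda>\<omega>. (2 * indicat_real A (X \<omega>) + indicat_real A (X \<omega>) * Z \<omega>) / m)"
    by (simp add: w_def algebra_simps add_divide_distrib)
  also have "\<dots> = (2 * expectation (\<lambda>\<omega>. indicat_real A (X \<omega>)) + expectation (\<lambda>\<omega>. indicat_real A (X \<omega>) * Z \<omega>)) / m"
  proof -
    have "integrable M (\<lambda>\<omega>. indicat_real A (X \<omega>))" "integrable M (\<lambda>\<omega>. indicat_real A (X \<omega>) * Z \<omega>)"
      using bound by (auto intro!: integrable_const_bound[of _ 1] split: split_indicator)
    then show ?thesis by simp
  qed
  finally show ?thesis
    using m by (simp add: field_simps m_def)
qed

text \<open>As \<open>s\<close> ranges over all reals, conjugating the hypothesis at \<open>-s\<close> gives the hypothesis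
  for the conjugate of \<open>Z\<close>, hence for its real and imaginary parts.\<close>

lemma (in prob_space) factorization_of_char_factorization:
  fixes Z :: "'a \<Rightarrow> complex"
  assumes X [measurable]: "X \<in> borel_measurable M" and Z [measurable]: "Z \<in> borel_measurable M"
    and bound: "\<And>\<omega>. \<omega> \<in> space M \<Longrightarrow> norm (Z \<omega>) \<le> 1"
    and factor: "\<And>s. (CLINT \<omega>|M. iexp (s * X \<omega>) * Z \<omega>)
      = (CLINT \<omega>|M. iexp (s * X \<omega>)) * (CLINT \<omega>|M. Z \<omega>)"
    and A [measurable]: "A \<in> sets borel"
  shows "(CLINT \<omega>|M. indicator A (X \<omega>) * Z \<omega>) = complex_of_real (prob (X -` A \<inter> space M)) * (CLINT \<omega>|M. Z \<omega>)"
proof -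
  have int_Z [simp]: "integrable M Z"
    using bound by (intro integrable_const_bound[of _ 1]) auto
  have factor_cnj: "(CLINT \<omega>|M. iexp (s * X \<omega>) * cnj (Z \<omega>))
      = (CLINT \<omega>|M. iexp (s * X \<omega>)) * cnj (CLINT \<omega>|M. Z \<omega>)" for s
  proof -
    have c: "iexp (s * y) = cnj (iexp ((- s) * y))" for y
      by (simp add: exp_cnj)
    have "(CLINT \<omega>|M. iexp (s * X \<omega>) * cnj (Z \<omega>)) = (CLINT \<omega>|M. cnj (iexp ((- s) * X \<omega>) * Z \<omega>))"
      unfolding c complex_cnj_mult ..
    also have "\<dots> = cnj (CLINT \<omega>|M. iexp ((- s) * X \<omega>) * Z \<omega>)"
      by (rule Bochner_Integration.integral_cnj)
    also have "\<dots> = cnj (CLINT \<omega>|M. iexp ((- s) * X \<omega>)) * cnj (CLINT \<omega>|M. Z \<omega>)"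
      unfolding factor complex_cnj_mult ..
    also have "cnj (CLINT \<omega>|M. iexp ((- s) * X \<omega>)) = (CLINT \<omega>|M. iexp (s * X \<omega>))"
      unfolding c by (rule Bochner_Integration.integral_cnj[symmetric])
    finally show ?thesis .
  qed
  have int: "integrable M (\<lambda>\<omega>. iexp (s * X \<omega>) * Z \<omega>)" "integrable M (\<lambda>\<omega>. iexp (s * X \<omega>) * cnj (Z \<omega>))" for s
  proof -
    have "(\<lambda>\<omega>. cnj (Z \<omega>)) \<in> borel_measurable M"
      by (rule measurable_compose[OF Z borel_measurable_continuous_onI]) (intro continuous_intros)
    then show "integrable M (\<lambda>\<omega>. iexp (s * X \<omega>) * cnj (Z \<omega>))"
      by (intro integrable_iexp_mult) (simp_all add: bound)
    show "integrable M (\<lambda>\<omega>. iexp (s * X \<omega>) * Z \<omega>)"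
      by (rule integrable_iexp_mult) (simp_all add: bound)
  qed
  have Re: "expectation (\<lambda>\<omega>. indicator A (X \<omega>) * Re (Z \<omega>))
      = expectation (\<lambda>\<omega>. indicator A (X \<omega>)) * expectation (\<lambda>\<omega>. Re (Z \<omega>))"
  proof (rule real_factorization_of_char_factorization)
    fix s
    have part: "complex_of_real (Re z) = (z + cnj z) / 2" for z
      by (simp add: complex_eq_iff)
    have "iexp (s * X \<omega>) * complex_of_real (Re (Z \<omega>))
        = (iexp (s * X \<omega>) * Z \<omega> + iexp (s * X \<omega>) * cnj (Z \<omega>)) / 2" for \<omega>
      unfolding part by (simp add: distrib_left)
    then have "(CLINT \<omega>|M. iexp (s * X \<omega>) * complex_of_real (Re (Z \<omega>)))
        = (CLINT \<omega>|M. (iexp (s * X \<omega>) * Z \<omega> + iexp (s * X \<omega>) * cnj (Z \<omega>)) / 2)"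
      by (simp only:)
    also have "\<dots> = ((CLINT \<omega>|M. iexp (s * X \<omega>) * Z \<omega>) + (CLINT \<omega>|M. iexp (s * X \<omega>) * cnj (Z \<omega>))) / 2"
      using int by simp
    also have "\<dots> = (CLINT \<omega>|M. iexp (s * X \<omega>)) * complex_of_real (Re (CLINT \<omega>|M. Z \<omega>))"
    proof -
      have "(e * z + e * cnj z) / 2 = e * complex_of_real (Re z)" for e z
        unfolding part by (simp add: distrib_left)
      then show ?thesis
        unfolding factor factor_cnj .
    qed
    finally show "(CLINT \<omega>|M. iexp (s * X \<omega>) * complex_of_real (Re (Z \<omega>)))
      = (CLINT \<omega>|M. iexp (s * X \<omega>)) * complex_of_real (expectation (\<lambda>\<omega>. Re (Z \<omega>)))"
      by simp
    show "\<bar>Re (Z \<omega>)\<bar> \<le> 1" if "\<omega> \<in> space M" for \<omega>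
      using bound[OF that] abs_Re_le_cmod[of "Z \<omega>"] by linarith
    show "(\<lambda>\<omega>. Re (Z \<omega>)) \<in> borel_measurable M"
      by measurable
  qed (use A in auto)
  have Im: "expectation (\<lambda>\<omega>. indicator A (X \<omega>) * Im (Z \<omega>))
      = expectation (\<lambda>\<omega>. indicator A (X \<omega>)) * expectation (\<lambda>\<omega>. Im (Z \<omega>))"
  proof (rule real_factorization_of_char_factorization)
    fix s
    have part: "complex_of_real (Im z) = (z - cnj z) / (2 * \<i>)" for z
      by (simp add: complex_eq_iff)
    have "iexp (s * X \<omega>) * complex_of_real (Im (Z \<omega>))
        = (iexp (s * X \<omega>) * Z \<omega> - iexp (s * X \<omega>) * cnj (Z \<omega>)) / (2 * \<i>)" for \<omega>
      unfolding part by (simp add: right_diff_distrib)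
    then have "(CLINT \<omega>|M. iexp (s * X \<omega>) * complex_of_real (Im (Z \<omega>)))
        = (CLINT \<omega>|M. (iexp (s * X \<omega>) * Z \<omega> - iexp (s * X \<omega>) * cnj (Z \<omega>)) / (2 * \<i>))"
      by (simp only:)
    also have "\<dots> = ((CLINT \<omega>|M. iexp (s * X \<omega>) * Z \<omega>) - (CLINT \<omega>|M. iexp (s * X \<omega>) * cnj (Z \<omega>))) / (2 * \<i>)"
      using int by simp
    also have "\<dots> = (CLINT \<omega>|M. iexp (s * X \<omega>)) * complex_of_real (Im (CLINT \<omega>|M. Z \<omega>))"
    proof -
      have "(e * z - e * cnj z) / (2 * \<i>) = e * complex_of_real (Im z)" for e z
        unfolding part by (simp add: right_diff_distrib)
      then show ?thesis
        unfolding factor factor_cnj .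
    qed
    finally show "(CLINT \<omega>|M. iexp (s * X \<omega>) * complex_of_real (Im (Z \<omega>)))
      = (CLINT \<omega>|M. iexp (s * X \<omega>)) * complex_of_real (expectation (\<lambda>\<omega>. Im (Z \<omega>)))"
      by simp
    show "\<bar>Im (Z \<omega>)\<bar> \<le> 1" if "\<omega> \<in> space M" for \<omega>
      using bound[OF that] abs_Im_le_cmod[of "Z \<omega>"] by linarith
    show "(\<lambda>\<omega>. Im (Z \<omega>)) \<in> borel_measurable M"
      by measurable
  qed (use A in auto)
  have p: "expectation (\<lambda>\<omega>. indicator A (X \<omega>)) = prob (X -` A \<inter> space M)"
  proof -
    have "expectation (\<lambda>\<omega>. indicat_real A (X \<omega>)) = expectation (indicat_real (X -` A \<inter> space M))"
      by (intro Bochner_Integration.integral_cong) (auto split: split_indicator)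
    then show ?thesis by simp
  qed
  have "integrable M (\<lambda>\<omega>. indicator A (X \<omega>) * Z \<omega>)"
    using bound by (intro integrable_const_bound[of _ 1]) (auto split: split_indicator)
  then have "Re (CLINT \<omega>|M. indicator A (X \<omega>) * Z \<omega>) = expectation (\<lambda>\<omega>. indicator A (X \<omega>) * Re (Z \<omega>))"
    "Im (CLINT \<omega>|M. indicator A (X \<omega>) * Z \<omega>) = expectation (\<lambda>\<omega>. indicator A (X \<omega>) * Im (Z \<omega>))"
    by (auto simp: integral_Re[symmetric] integral_Im[symmetric] simp del: integral_Re integral_Im
        intro!: Bochner_Integration.integral_cong split: split_indicator)
  then show ?thesis
    unfolding Re Im p by (simp add: complex_eq_iff)
qed

text \<open>The characters \<open>exp (i a\<^sub>k X\<^sub>k)\<close> are exchanged for the indicators of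
  \<open>X\<^sub>k \<in> A\<^sub>k\<close> one at a time, so that only the uniqueness theorem on the real line enters. In each
  exchange the remaining factors form the bounded weight \<open>Z\<close> of the preceding lemma.\<close>

lemma (in prob_space) indep_vars_of_char_factorization:
  fixes X :: "'i \<Rightarrow> 'a \<Rightarrow> real"
  assumes I: "finite I"
    and X [measurable]: "\<And>i. i \<in> I \<Longrightarrow> X i \<in> borel_measurable M"
    and factor: "\<And>a. (CLINT \<omega>|M. iexp (\<Sum>i\<in>I. a i * X i \<omega>)) = (\<Prod>i\<in>I. CLINT \<omega>|M. iexp (a i * X i \<omega>))"
  shows "indep_vars (\<lambda>_. borel) X I"
proof (cases "I = {}")
  case True
  then show ?thesis by (simp add: indep_vars_def2 indep_sets_def)
next
  case False
  have partial: "(CLINT \<omega>|M. (\<Prod>i\<in>J. indicator (A i) (X i \<omega>)) * iexp (\<Sum>i\<in>I - J. a i * X i \<omega>))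
      = (\<Prod>i\<in>J. complex_of_real (prob (X i -` A i \<inter> space M))) * (\<Prod>i\<in>I - J. CLINT \<omega>|M. iexp (a i * X i \<omega>))"
    if J: "J \<subseteq> I" and A: "\<And>i. i \<in> I \<Longrightarrow> A i \<in> sets borel" for J A a
    using finite_subset[OF J I] J
  proof (induction J arbitrary: a rule: finite_induct)
    case empty
    show ?case using factor[of a] by (simp del: of_real_mult of_real_sum)
  next
    case (insert k J)
    then have k: "k \<in> I" "k \<notin> J" and J: "J \<subseteq> I" "finite J" and IJ: "I - J = insert k (I - insert k J)"
      by auto
    note [measurable] = X[OF k(1)]
    define Z where "Z \<omega> = (\<Prod>i\<in>J. indicator (A i) (X i \<omega>)) * iexp (\<Sum>i\<in>I - insert k J. a i * X i \<omega>)" for \<omega>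
    define c where "c = (\<Prod>i\<in>J. complex_of_real (prob (X i -` A i \<inter> space M)))"
    define d where "d = (\<Prod>i\<in>I - insert k J. CLINT \<omega>|M. iexp (a i * X i \<omega>))"
    have prod_ind: "norm (\<Prod>i\<in>J. indicator (A i) (X i \<omega>) :: complex) \<le> 1" for \<omega>
      unfolding prod_norm[symmetric] by (rule prod_le_1) (auto split: split_indicator)
    have Z_meas: "Z \<in> borel_measurable M"
      unfolding Z_def[abs_def]
    proof (intro borel_measurable_times borel_measurable_prod)
      fix i assume "i \<in> J"
      then have [measurable]: "X i \<in> borel_measurable M" "A i \<in> sets borel"
        using J(1) X A by auto
      show "(\<lambda>\<omega>. indicator (A i) (X i \<omega>) :: complex) \<in> borel_measurable M"
        by measurable
    next
      have [measurable]: "(\<lambda>\<omega>. \<Sum>i\<in>I - insert k J. a i * X i \<omega>) \<in> borel_measurable M"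
        using X by (intro borel_measurable_sum) auto
      show "(\<lambda>\<omega>. iexp (\<Sum>i\<in>I - insert k J. a i * X i \<omega>)) \<in> borel_measurable M"
        by measurable
    qed
    have Z_char: "(CLINT \<omega>|M. iexp (s * X k \<omega>) * Z \<omega>) = (CLINT \<omega>|M. iexp (s * X k \<omega>)) * (c * d)" for s
    proof -
      let ?b = "a(k := s)"
      have "iexp (s * X k \<omega>) * Z \<omega> = (\<Prod>i\<in>J. indicator (A i) (X i \<omega>)) * iexp (\<Sum>i\<in>I - J. ?b i * X i \<omega>)" for \<omega>
      proof -
        have "(\<Sum>i\<in>I - J. ?b i * X i \<omega>) = s * X k \<omega> + (\<Sum>i\<in>I - insert k J. ?b i * X i \<omega>)"
          unfolding IJ using I by simp
        also have "(\<Sum>i\<in>I - insert k J. ?b i * X i \<omega>) = (\<Sum>i\<in>I - insert k J. a i * X i \<omega>)"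
          by (rule sum.cong) auto
        finally show ?thesis
          by (simp add: Z_def exp_add algebra_simps)
      qed
      then have "(CLINT \<omega>|M. iexp (s * X k \<omega>) * Z \<omega>)
          = c * (\<Prod>i\<in>I - J. CLINT \<omega>|M. iexp (?b i * X i \<omega>))"
        using insert.IH[OF J(1), of ?b] by (simp only: c_def)
      also have "(\<Prod>i\<in>I - J. CLINT \<omega>|M. iexp (?b i * X i \<omega>))
          = (CLINT \<omega>|M. iexp (s * X k \<omega>)) * (\<Prod>i\<in>I - insert k J. CLINT \<omega>|M. iexp (?b i * X i \<omega>))"
        unfolding IJ using I by simp
      also have "(\<Prod>i\<in>I - insert k J. CLINT \<omega>|M. iexp (?b i * X i \<omega>)) = d"
        unfolding d_def by (rule prod.cong) auto
      finally show ?thesis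
        by (simp add: algebra_simps)
    qed
    from Z_char[of 0] have Z_int: "(CLINT \<omega>|M. Z \<omega>) = c * d"
      by (simp add: prob_space)
    have "(CLINT \<omega>|M. (\<Prod>i\<in>insert k J. indicator (A i) (X i \<omega>)) * iexp (\<Sum>i\<in>I - insert k J. a i * X i \<omega>))
        = (CLINT \<omega>|M. indicator (A k) (X k \<omega>) * Z \<omega>)"
      using k J by (simp add: Z_def mult.assoc)
    also have "\<dots> = complex_of_real (prob (X k -` A k \<inter> space M)) * (CLINT \<omega>|M. Z \<omega>)"
    proof (rule factorization_of_char_factorization[OF X[OF k(1)] Z_meas])
      show "norm (Z \<omega>) \<le> 1" for \<omega>
        using prod_ind[of \<omega>] by (simp add: Z_def norm_mult)
      show "(CLINT \<omega>|M. iexp (s * X k \<omega>) * Z \<omega>) = (CLINT \<omega>|M. iexp (s * X k \<omega>)) * (CLINT \<omega>|M. Z \<omega>)" for s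
        unfolding Z_char Z_int ..
    qed (use A k in auto)
    also have "\<dots> = (\<Prod>i\<in>insert k J. complex_of_real (prob (X i -` A i \<inter> space M))) * d"
      using k J by (simp add: Z_int c_def)
    finally show ?case
      unfolding d_def .
  qed
  show ?thesis
  proof (subst indep_vars_finite[where E = "\<lambda>_. sets borel"])
    show "\<forall>A\<in>I \<rightarrow> sets borel. prob (\<Inter>j\<in>I. X j -` A j \<inter> space M) = (\<Prod>j\<in>I. prob (X j -` A j \<inter> space M))"
    proof
      fix A assume A: "A \<in> I \<rightarrow> (sets borel :: real set set)"
      have meas: "(\<Inter>j\<in>I. X j -` A j \<inter> space M) \<in> events"
        using A False I by (intro sets.finite_INT measurable_sets[OF X]) auto
      have "(CLINT \<omega>|M. (\<Prod>i\<in>I. indicator (A i) (X i \<omega>)))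
          = (CLINT \<omega>|M. complex_of_real (indicator (\<Inter>j\<in>I. X j -` A j \<inter> space M) \<omega>))"
        using I False
        by (intro Bochner_Integration.integral_cong refl) (auto simp: indicator_def prod_zero_iff intro!: prod.neutral)
      also have "\<dots> = complex_of_real (prob (\<Inter>j\<in>I. X j -` A j \<inter> space M))"
      proof -
        have "(CLINT \<omega>|M. complex_of_real (indicator E \<omega>)) = complex_of_real (prob E)" if "E \<in> events" for E
          using sets.sets_into_space[OF that] by (simp add: Int_absorb2)
        then show ?thesis using meas by blast
      qed
      finally show "prob (\<Inter>j\<in>I. X j -` A j \<inter> space M) = (\<Prod>j\<in>I. prob (X j -` A j \<inter> space M))"
        using partial[of I A] A by (simp add: Pi_iff flip: of_real_prod)
    qed
    show "sets borel = sigma_sets (space borel) (sets (borel :: real measure))"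
      by (rule sets.sigma_sets_eq[symmetric])
  qed (use I False X in \<open>auto simp: Int_stable_def\<close>)
qed

text \<open>Phrasing the law as the image of the standard normal distribution under scaling covers the degenerate
  case \<open>\<sigma> = 0\<close> as well, which has no density.\<close>

lemma (in prob_space) distr_eq_scaled_std_normal:
  assumes X [measurable]: "X \<in> borel_measurable M"
    and char: "\<And>s. (CLINT \<omega>|M. iexp (s * X \<omega>)) = complex_of_real (exp (- (\<sigma> * s)\<^sup>2 / 2))"
  shows "distr M borel X = distr std_normal_distribution borel (\<lambda>z. \<sigma> * z)"
proof (rule Levy_uniqueness)
  interpret N: real_distribution std_normal_distribution
    by (rule real_dist_normal_dist)
  have [measurable]: "(\<lambda>z. \<sigma> * z) \<in> borel_measurable std_normal_distribution"
    by simp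
  show "real_distribution (distr M borel X)" "real_distribution (distr std_normal_distribution borel (\<lambda>z. \<sigma> * z))"
    by auto
  show "char (distr M borel X) = char (distr std_normal_distribution borel (\<lambda>z. \<sigma> * z))"
  proof
    fix s
    have "char (distr std_normal_distribution borel (\<lambda>z. \<sigma> * z)) s = char std_normal_distribution (\<sigma> * s)"
      by (subst N.char_distr_eq) (simp_all add: char_def algebra_simps)
    then show "char (distr M borel X) s = char (distr std_normal_distribution borel (\<lambda>z. \<sigma> * z)) s"
      unfolding char_distr_eq[OF X] char char_std_normal_distribution by simp
  qed
qed

lemma (in prob_space) square_integrable_of_normal_char:
  assumes X [measurable]: "X \<in> borel_measurable M"
    and char: "\<And>s. (CLINT \<omega>|M. iexp (s * X \<omega>)) = complex_of_real (exp (- (\<sigma> * s)\<^sup>2 / 2))"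
  shows "square_integrable M X"
proof -
  have "integrable std_normal_distribution (\<lambda>z. \<sigma>\<^sup>2 * z\<^sup>2)"
    using integrable_std_normal_distribution_moment[of 2] by simp
  then have "integrable (distr std_normal_distribution borel (\<lambda>z. \<sigma> * z)) (\<lambda>x. x\<^sup>2)"
    by (subst integrable_distr_eq) (auto simp: power_mult_distrib)
  then have "integrable (distr M borel X) (\<lambda>x. x\<^sup>2)"
    by (simp add: distr_eq_scaled_std_normal[OF X char])
  then show ?thesis
    by (simp add: square_integrable_def integrable_distr_eq)
qed

lemma (in prob_space) normal_of_char:
  assumes X [measurable]: "X \<in> borel_measurable M" and \<sigma>: "\<sigma> > 0"
    and char: "\<And>s. (CLINT \<omega>|M. iexp (s * X \<omega>)) = complex_of_real (exp (- (\<sigma> * s)\<^sup>2 / 2))"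
  shows "distributed M lborel X (normal_density 0 \<sigma>)"
proof -
  have "distr M borel (\<lambda>\<omega>. X \<omega> / \<sigma>) = distr std_normal_distribution borel (\<lambda>z. 1 * z)"
  proof (rule distr_eq_scaled_std_normal)
    fix s
    show "(CLINT \<omega>|M. iexp (s * (X \<omega> / \<sigma>))) = complex_of_real (exp (- (1 * s)\<^sup>2 / 2))"
      using char[of "s / \<sigma>"] \<sigma> by simp
  qed simp
  also have "\<dots> = distr std_normal_distribution std_normal_distribution (\<lambda>z. z)"
    by (intro distr_cong) auto
  also have "\<dots> = std_normal_distribution"
    by (rule distr_id)
  finally have "distr M lborel (\<lambda>\<omega>. X \<omega> / \<sigma>) = std_normal_distribution"
    by (metis distr_cong sets_lborel)
  then have "distributed M lborel (\<lambda>\<omega>. (X \<omega> - 0) / \<sigma>) std_normal_density"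
    by (simp add: distributed_def)
  then show ?thesis
    using normal_standard_normal_convert[OF \<sigma>, of X 0] by simp
qed

section \<open>White noise\<close>

lemma weak_star_open_subset: "openin weak_star_topology A \<Longrightarrow> A \<subseteq> distributions_half"
proof -
  have "topspace weak_star_topology \<subseteq> distributions_half"
    unfolding weak_star_topology_def topology_generated_by_topspace by auto
  then show "openin weak_star_topology A \<Longrightarrow> A \<subseteq> distributions_half"
    using openin_subset by blast
qed

lemma evaluation_measurable:
  assumes P: "white_noise_measure P" and \<phi>: "\<phi> \<in> schwartz_half"
  shows "(\<lambda>\<omega>. \<omega> \<phi>) \<in> borel_measurable P"
proof (rule borel_measurableI)
  fix U :: "real set" assume "open U"
  then have "openin weak_star_topology {\<omega> \<in> distributions_half. \<omega> \<phi> \<in> U}"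
    unfolding weak_star_topology_def using \<phi> by (intro topology_generated_by_Basis) auto
  moreover have "{A. openin weak_star_topology A} \<subseteq> Pow distributions_half"
    using weak_star_open_subset by auto
  ultimately have "{\<omega> \<in> distributions_half. \<omega> \<phi> \<in> U} \<in> sets weak_star_borel"
    unfolding weak_star_borel_def by (auto simp: sets_measure_of)
  moreover have "(\<lambda>\<omega>. \<omega> \<phi>) -` U \<inter> space P = {\<omega> \<in> distributions_half. \<omega> \<phi> \<in> U}"
    using P by (auto simp: white_noise_measure_def)
  ultimately show "(\<lambda>\<omega>. \<omega> \<phi>) -` U \<inter> space P \<in> sets P"
    using P by (simp add: white_noise_measure_def)
qed

lemma restrict_in_schwartz_half: "\<phi> \<in> schwartz \<Longrightarrow> restrict \<phi> half_plane \<in> schwartz_half"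
  by (auto simp: schwartz_half_def)

lemma white_noise_measurable:
  "white_noise_measure P \<Longrightarrow> \<phi> \<in> schwartz \<Longrightarrow> (\<lambda>\<omega>. white_noise \<omega> \<phi>) \<in> borel_measurable P"
  unfolding white_noise_def by (intro evaluation_measurable restrict_in_schwartz_half)

lemma white_noise_linear:
  assumes P: "white_noise_measure P" and \<omega>: "\<omega> \<in> space P" and \<phi>: "\<phi> \<in> schwartz" and \<psi>: "\<psi> \<in> schwartz"
  shows "white_noise \<omega> (\<lambda>z. a * \<phi> z + b * \<psi> z) = a * white_noise \<omega> \<phi> + b * white_noise \<omega> \<psi>"
proof -
  have eq: "restrict (\<lambda>z. a * \<phi> z + b * \<psi> z) half_plane
      = (\<lambda>z\<in>half_plane. a * restrict \<phi> half_plane z + b * restrict \<psi> half_plane z)"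
    by (auto simp: restrict_def)
  have "\<omega> \<in> distributions_half"
    using P \<omega> by (simp add: white_noise_measure_def)
  then have lin: "\<forall>\<phi>\<in>schwartz_half. \<forall>\<psi>\<in>schwartz_half. \<forall>a b.
      \<omega> (\<lambda>z\<in>half_plane. a * \<phi> z + b * \<psi> z) = a * \<omega> \<phi> + b * \<omega> \<psi>"
    unfolding distributions_half_def by blast
  show ?thesis
    unfolding white_noise_def eq
    by (rule lin[rule_format, OF restrict_in_schwartz_half[OF \<phi>] restrict_in_schwartz_half[OF \<psi>]])
qed

lemma l2_norm_restrict: "l2_norm (lebesgue_on S) (restrict f S) = l2_norm (lebesgue_on S) f"
  unfolding l2_norm_def by (intro arg_cong[where f = sqrt] Bochner_Integration.integral_cong) (auto simp: space_restrict_space)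

lemma prob_space_white_noise: "white_noise_measure P \<Longrightarrow> prob_space (completion P)"
  by (simp add: white_noise_measure_def prob_space.prob_space_completion)

lemma white_noise_char:
  assumes P: "white_noise_measure P" and \<phi>: "\<phi> \<in> schwartz"
  shows "(CLINT \<omega>|completion P. iexp (white_noise \<omega> \<phi>))
    = complex_of_real (exp (- (l2_norm (lebesgue_on half_plane) \<phi>)\<^sup>2 / 2))"
proof -
  note [measurable] = white_noise_measurable[OF P \<phi>]
  have "(CLINT \<omega>|completion P. iexp (white_noise \<omega> \<phi>)) = (CLINT \<omega>|P. iexp (white_noise \<omega> \<phi>))"
    by (intro integral_completion) measurable
  also have "\<dots> = complex_of_real (exp (- (1 / 2) * (l2_norm (lebesgue_on half_plane) (restrict \<phi> half_plane))\<^sup>2))"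
    using P restrict_in_schwartz_half[OF \<phi>] unfolding white_noise_measure_def white_noise_def by blast
  finally show ?thesis
    by (simp add: l2_norm_restrict)
qed

text \<open>The Bochner integral of a function that is not integrable is \<open>0\<close>. Hence a vanishing limit of
  \<^const>\<open>l2_norm\<close> carries information only for square-integrable functions. This lemma secures square
  integrability on the probability space, as \<open>schwartz_square_integrable_half_plane\<close> does on the half-plane.\<close>

lemma white_noise_square_integrable:
  assumes P: "white_noise_measure P" and \<phi>: "\<phi> \<in> schwartz"
  shows "square_integrable (completion P) (\<lambda>\<omega>. white_noise \<omega> \<phi>)"
proof -
  interpret prob_space "completion P"
    by (rule prob_space_white_noise[OF P])
  show ?thesis
  proof (rule square_integrable_of_normal_char)
    show "(\<lambda>\<omega>. white_noise \<omega> \<phi>) \<in> borel_measurable (completion P)"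
      by (intro measurable_completion white_noise_measurable P \<phi>)
    fix s
    have "white_noise \<omega> (\<lambda>z. s * \<phi> z) = s * white_noise \<omega> \<phi>" if "\<omega> \<in> space (completion P)" for \<omega>
      using white_noise_linear[OF P _ \<phi> \<phi>, of \<omega> s 0] that by simp
    then have "(CLINT \<omega>|completion P. iexp (s * white_noise \<omega> \<phi>))
        = (CLINT \<omega>|completion P. iexp (white_noise \<omega> (\<lambda>z. s * \<phi> z)))"
      by (intro Bochner_Integration.integral_cong) simp_all
    also have "\<dots> = complex_of_real (exp (- (l2_norm (lebesgue_on half_plane) (\<lambda>z. s * \<phi> z))\<^sup>2 / 2))"
      using schwartz_linear[OF \<phi> \<phi>, of s 0] by (intro white_noise_char[OF P]) simp
    also have "\<dots> = complex_of_real (exp (- (l2_norm (lebesgue_on half_plane) \<phi> * s)\<^sup>2 / 2))"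
      by (simp add: l2_norm_scale power_mult_distrib mult.commute)
    finally show "(CLINT \<omega>|completion P. iexp (s * white_noise \<omega> \<phi>))
      = complex_of_real (exp (- (l2_norm (lebesgue_on half_plane) \<phi> * s)\<^sup>2 / 2))" .
  qed
qed

lemma white_noise_version_linear:
  assumes P: "white_noise_measure P"
    and X: "white_noise_version P f X" and Y: "white_noise_version P g Y"
  shows "white_noise_version P (\<lambda>z. a * f z + b * g z) (\<lambda>\<omega>. a * X \<omega> + b * Y \<omega>)"
proof -
  interpret prob_space "completion P"
    by (rule prob_space_white_noise[OF P])
  let ?H = "lebesgue_on half_plane"
  have sq: "square_integrable lebesgue f" "square_integrable lebesgue g"
    "square_integrable (completion P) X" "square_integrable (completion P) Y"
    using X Y by (auto simp: white_noise_version_def)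
  obtain \<phi> where \<phi>: "\<And>n::nat. \<phi> n \<in> schwartz" "(\<lambda>n. l2_norm ?H (\<lambda>z. \<phi> n z - f z)) \<longlonglongrightarrow> 0"
    "(\<lambda>n. l2_norm (completion P) (\<lambda>\<omega>. white_noise \<omega> (\<phi> n) - X \<omega>)) \<longlonglongrightarrow> 0"
    using X by (auto simp: white_noise_version_def)
  obtain \<psi> where \<psi>: "\<And>n::nat. \<psi> n \<in> schwartz" "(\<lambda>n. l2_norm ?H (\<lambda>z. \<psi> n z - g z)) \<longlonglongrightarrow> 0"
    "(\<lambda>n. l2_norm (completion P) (\<lambda>\<omega>. white_noise \<omega> (\<psi> n) - Y \<omega>)) \<longlonglongrightarrow> 0"
    using Y by (auto simp: white_noise_version_def)
  let ?\<theta> = "\<lambda>n z. a * \<phi> n z + b * \<psi> n z"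
  have "(\<lambda>n. l2_norm ?H (\<lambda>z. ?\<theta> n z - (a * f z + b * g z))) \<longlonglongrightarrow> 0"
    using \<phi> \<psi> sq
    by (intro tendsto_l2_norm_linear schwartz_square_integrable_half_plane square_integrable_half_plane)
  moreover have "(\<lambda>n. l2_norm (completion P) (\<lambda>\<omega>. white_noise \<omega> (?\<theta> n) - (a * X \<omega> + b * Y \<omega>))) \<longlonglongrightarrow> 0"
  proof -
    have "l2_norm (completion P) (\<lambda>\<omega>. white_noise \<omega> (?\<theta> n) - (a * X \<omega> + b * Y \<omega>))
        = l2_norm (completion P) (\<lambda>\<omega>. (a * white_noise \<omega> (\<phi> n) + b * white_noise \<omega> (\<psi> n)) - (a * X \<omega> + b * Y \<omega>))" for n
      unfolding l2_norm_def using white_noise_linear[OF P _ \<phi>(1) \<psi>(1)]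
      by (intro arg_cong[where f = sqrt] Bochner_Integration.integral_cong) simp_all
    then show ?thesis
      using tendsto_l2_norm_linear[OF white_noise_square_integrable[OF P \<phi>(1)] sq(3) \<phi>(3)
          white_noise_square_integrable[OF P \<psi>(1)] sq(4) \<psi>(3), of a b] by simp
  qed
  moreover have "?\<theta> n \<in> schwartz" for n
    by (intro schwartz_linear \<phi>(1) \<psi>(1))
  ultimately show ?thesis
    unfolding white_noise_version_def using sq by (auto intro!: square_integrable_linear exI[of _ ?\<theta>])
qed

lemma white_noise_version_zero:
  assumes P: "white_noise_measure P"
  shows "white_noise_version P (\<lambda>_. 0) (\<lambda>_. 0)"
proof -
  have "white_noise \<omega> (\<lambda>_. 0) = 0" if "\<omega> \<in> space P" for \<omega>
    using white_noise_linear[OF P that zero_in_schwartz zero_in_schwartz, of 0 0] by simp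
  then have "l2_norm (completion P) (\<lambda>\<omega>. white_noise \<omega> (\<lambda>_. 0) - 0) = l2_norm (completion P) (\<lambda>_. 0)"
    unfolding l2_norm_def by (intro arg_cong[where f = sqrt] Bochner_Integration.integral_cong) simp_all
  then show ?thesis
    unfolding white_noise_version_def
    by (auto simp: square_integrable_def l2_norm_def zero_in_schwartz intro!: exI[of _ "\<lambda>_ _. 0"])
qed

lemma white_noise_version_sum:
  assumes P: "white_noise_measure P" and X: "\<And>i. i \<in> I \<Longrightarrow> white_noise_version P (f i) (X i)"
  shows "white_noise_version P (\<lambda>z. \<Sum>i\<in>I. a i * f i z) (\<lambda>\<omega>. \<Sum>i\<in>I. a i * X i \<omega>)"
  using X
proof (induction I rule: infinite_finite_induct)
  case (insert i I)
  then show ?case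
    using white_noise_version_linear[OF P, of "f i" "X i" "\<lambda>z. \<Sum>i\<in>I. a i * f i z" "\<lambda>\<omega>. \<Sum>i\<in>I. a i * X i \<omega>" "a i" 1]
    by simp
qed (simp_all add: white_noise_version_zero[OF P])

lemma norm_iexp_diff_le: "norm (iexp x - iexp y) \<le> \<bar>x - y\<bar>"
proof -
  have "iexp x - iexp y = iexp y * (iexp (x - y) - 1)"
    by (simp add: algebra_simps exp_diff)
  then have "norm (iexp x - iexp y) = norm (iexp (x - y) - 1)"
    by (simp add: norm_mult)
  also have "\<dots> \<le> \<bar>x - y\<bar>"
    using iexp_approx1[of "x - y" 0] by simp
  finally show ?thesis .
qed

text \<open>Both sides are continuous in mean square: the left-hand side because \<open>x \<mapsto> exp (i x)\<close> is
  1-Lipschitz, the right-hand side by the reverse triangle inequality.\<close>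

lemma white_noise_version_char:
  assumes P: "white_noise_measure P" and X: "white_noise_version P f X"
  shows "(CLINT \<omega>|completion P. iexp (X \<omega>))
    = complex_of_real (exp (- (l2_norm (lebesgue_on half_plane) f)\<^sup>2 / 2))"
proof -
  interpret prob_space "completion P"
    by (rule prob_space_white_noise[OF P])
  let ?H = "lebesgue_on half_plane"
  have sq: "square_integrable lebesgue f" "square_integrable (completion P) X"
    using X by (auto simp: white_noise_version_def)
  then have [measurable]: "X \<in> borel_measurable (completion P)"
    by (simp add: square_integrable_def)
  obtain \<phi> where \<phi>: "\<And>n::nat. \<phi> n \<in> schwartz" "(\<lambda>n. l2_norm ?H (\<lambda>z. \<phi> n z - f z)) \<longlonglongrightarrow> 0"
    "(\<lambda>n. l2_norm (completion P) (\<lambda>\<omega>. white_noise \<omega> (\<phi> n) - X \<omega>)) \<longlonglongrightarrow> 0"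
    using X by (auto simp: white_noise_version_def)
  have [measurable]: "(\<lambda>\<omega>. white_noise \<omega> (\<phi> n)) \<in> borel_measurable (completion P)" for n
    by (intro measurable_completion white_noise_measurable P \<phi>)
  have "(\<lambda>n. l2_norm ?H (\<phi> n)) \<longlonglongrightarrow> l2_norm ?H f"
    using \<phi> sq by (intro tendsto_l2_norm schwartz_square_integrable_half_plane square_integrable_half_plane)
  then have "(\<lambda>n. complex_of_real (exp (- (l2_norm ?H (\<phi> n))\<^sup>2 / 2))) \<longlonglongrightarrow> complex_of_real (exp (- (l2_norm ?H f)\<^sup>2 / 2))"
    by (intro tendsto_intros) auto
  then have lim1: "(\<lambda>n. CLINT \<omega>|completion P. iexp (white_noise \<omega> (\<phi> n))) \<longlonglongrightarrow> complex_of_real (exp (- (l2_norm ?H f)\<^sup>2 / 2))"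
    unfolding white_noise_char[OF P \<phi>(1)] .
  have lim2: "(\<lambda>n. CLINT \<omega>|completion P. iexp (white_noise \<omega> (\<phi> n))) \<longlonglongrightarrow> (CLINT \<omega>|completion P. iexp (X \<omega>))"
  proof (rule Lim_transform2[OF tendsto_const], rule Lim_null_comparison[OF _ \<phi>(3)])
    have "norm ((CLINT \<omega>|completion P. iexp (X \<omega>)) - (CLINT \<omega>|completion P. iexp (white_noise \<omega> (\<phi> n))))
        \<le> l2_norm (completion P) (\<lambda>\<omega>. white_noise \<omega> (\<phi> n) - X \<omega>)" for n
    proof -
      let ?D = "\<lambda>\<omega>. white_noise \<omega> (\<phi> n) - X \<omega>"
      have D: "square_integrable (completion P) ?D"
        by (intro square_integrable_diff white_noise_square_integrable P \<phi> sq)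
      have int: "integrable (completion P) (\<lambda>\<omega>. iexp (X \<omega>))" "integrable (completion P) (\<lambda>\<omega>. iexp (white_noise \<omega> (\<phi> n)))"
        by (auto intro!: integrable_iexp)
      then have "norm ((CLINT \<omega>|completion P. iexp (X \<omega>)) - (CLINT \<omega>|completion P. iexp (white_noise \<omega> (\<phi> n))))
          = norm (CLINT \<omega>|completion P. iexp (X \<omega>) - iexp (white_noise \<omega> (\<phi> n)))"
        by simp
      also have "\<dots> \<le> expectation (\<lambda>\<omega>. norm (iexp (X \<omega>) - iexp (white_noise \<omega> (\<phi> n))))"
        by (rule integral_norm_bound)
      also have "\<dots> \<le> expectation (\<lambda>\<omega>. \<bar>?D \<omega>\<bar>)"
      proof (rule integral_mono)
        show "integrable (completion P) (\<lambda>\<omega>. \<bar>?D \<omega>\<bar>)"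
          using D by (auto simp: square_integrable_def intro: square_integrable_imp_integrable)
        show "norm (iexp (X \<omega>) - iexp (white_noise \<omega> (\<phi> n))) \<le> \<bar>?D \<omega>\<bar>" for \<omega>
          using norm_iexp_diff_le[of "X \<omega>" "white_noise \<omega> (\<phi> n)"] by (simp add: abs_minus_commute)
      qed (use int in auto)
      also have "\<dots> \<le> l2_norm (completion P) ?D"
        by (rule expectation_abs_le_l2_norm[OF D])
      finally show ?thesis .
    qed
    then show "\<forall>\<^sub>F n in sequentially. norm ((CLINT \<omega>|completion P. iexp (X \<omega>)) - (CLINT \<omega>|completion P. iexp (white_noise \<omega> (\<phi> n))))
        \<le> l2_norm (completion P) (\<lambda>\<omega>. white_noise \<omega> (\<phi> n) - X \<omega>)"
      by simp
  qed
  show ?thesis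
    by (rule LIMSEQ_unique[OF lim2 lim1])
qed

lemma white_noise_version_normal:
  assumes P: "white_noise_measure P" and X: "white_noise_version P f X"
    and pos: "0 < l2_norm (lebesgue_on half_plane) f"
  shows "distributed (completion P) lborel X (normal_density 0 (l2_norm (lebesgue_on half_plane) f))"
proof -
  interpret prob_space "completion P"
    by (rule prob_space_white_noise[OF P])
  show ?thesis
  proof (rule normal_of_char[OF _ pos])
    show "X \<in> borel_measurable (completion P)"
      using X by (simp add: white_noise_version_def square_integrable_def)
    fix s
    show "(CLINT \<omega>|completion P. iexp (s * X \<omega>))
      = complex_of_real (exp (- (l2_norm (lebesgue_on half_plane) f * s)\<^sup>2 / 2))"
      using white_noise_version_char[OF P white_noise_version_linear[OF P X X, of s 0]]
      by (simp add: l2_norm_scale power_mult_distrib mult.commute)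
  qed
qed

text \<open>By the theorem of Pythagoras, orthogonality makes the characteristic function
  \<open>exp (- \<parallel>\<Sum>\<^sub>i a\<^sub>i f\<^sub>i\<parallel>\<^sup>2 / 2)\<close> of a linear combination a product over \<open>i\<close>.\<close>

lemma white_noise_version_indep:
  assumes P: "white_noise_measure P" and I: "finite I"
    and X: "\<And>i. i \<in> I \<Longrightarrow> white_noise_version P (f i) (X i)"
    and orth: "\<And>i j. i \<in> I \<Longrightarrow> j \<in> I \<Longrightarrow> i \<noteq> j \<Longrightarrow> (\<integral>z. f i z * f j z \<partial>lebesgue_on half_plane) = 0"
  shows "prob_space.indep_vars (completion P) (\<lambda>_. borel) X I"
proof -
  interpret prob_space "completion P"
    by (rule prob_space_white_noise[OF P])
  let ?H = "lebesgue_on half_plane"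
  have sq: "square_integrable ?H (f i)" if "i \<in> I" for i
    using X[OF that] by (auto simp: white_noise_version_def intro: square_integrable_half_plane)
  show ?thesis
  proof (rule indep_vars_of_char_factorization[OF I])
    show "X i \<in> borel_measurable (completion P)" if "i \<in> I" for i
      using X[OF that] by (simp add: white_noise_version_def square_integrable_def)
    fix a :: "_ \<Rightarrow> real"
    have single: "(CLINT \<omega>|completion P. iexp (a i * X i \<omega>)) = complex_of_real (exp (- (a i)\<^sup>2 * (l2_norm ?H (f i))\<^sup>2 / 2))"
      if "i \<in> I" for i
      using white_noise_version_char[OF P white_noise_version_linear[OF P X[OF that] X[OF that], of "a i" 0]]
      by (simp add: l2_norm_scale power_mult_distrib)
    have int: "integrable ?H (\<lambda>z. (a i * f i z) * (a j * f j z))" if "i \<in> I" "j \<in> I" for i j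
      using square_integrable_integrable_mult[OF sq[OF that(1)] sq[OF that(2)]] by (simp add: ac_simps)
    have "(l2_norm ?H (\<lambda>z. \<Sum>i\<in>I. a i * f i z))\<^sup>2 = (\<integral>z. (\<Sum>i\<in>I. \<Sum>j\<in>I. (a i * f i z) * (a j * f j z)) \<partial>?H)"
      unfolding l2_norm_squared by (simp add: power2_eq_square sum_product)
    also have "\<dots> = (\<Sum>i\<in>I. \<Sum>j\<in>I. (\<integral>z. (a i * f i z) * (a j * f j z) \<partial>?H))"
      using int by (simp add: Bochner_Integration.integral_sum Bochner_Integration.integrable_sum)
    also have "\<dots> = (\<Sum>i\<in>I. \<Sum>j\<in>I. if i = j then (a i)\<^sup>2 * (l2_norm ?H (f i))\<^sup>2 else 0)"
    proof (intro sum.cong refl)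
      fix i j assume ij: "i \<in> I" "j \<in> I"
      have "(\<integral>z. (a i * f i z) * (a j * f j z) \<partial>?H) = (\<integral>z. (a i * a j) * (f i z * f j z) \<partial>?H)"
        by (simp add: ac_simps)
      also have "\<dots> = (a i * a j) * (\<integral>z. f i z * f j z \<partial>?H)"
        by simp
      finally show "(\<integral>z. (a i * f i z) * (a j * f j z) \<partial>?H) = (if i = j then (a i)\<^sup>2 * (l2_norm ?H (f i))\<^sup>2 else 0)"
        using orth[OF ij] by (cases "i = j") (simp_all add: l2_norm_squared flip: power2_eq_square)
    qed
    also have "\<dots> = (\<Sum>i\<in>I. (a i)\<^sup>2 * (l2_norm ?H (f i))\<^sup>2)"
      using I by simp
    finally have norm_sum: "(l2_norm ?H (\<lambda>z. \<Sum>i\<in>I. a i * f i z))\<^sup>2 = (\<Sum>i\<in>I. (a i)\<^sup>2 * (l2_norm ?H (f i))\<^sup>2)" .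
    have version: "white_noise_version P (\<lambda>z. \<Sum>i\<in>I. a i * f i z) (\<lambda>\<omega>. \<Sum>i\<in>I. a i * X i \<omega>)"
      by (rule white_noise_version_sum[OF P X])
    have "(CLINT \<omega>|completion P. iexp (\<Sum>i\<in>I. a i * X i \<omega>))
        = complex_of_real (exp (\<Sum>i\<in>I. - (a i)\<^sup>2 * (l2_norm ?H (f i))\<^sup>2 / 2))"
      using white_noise_version_char[OF P version]
      unfolding norm_sum by (simp add: sum_negf sum_divide_distrib del: of_real_sum of_real_mult)
    also have "\<dots> = (\<Prod>i\<in>I. complex_of_real (exp (- (a i)\<^sup>2 * (l2_norm ?H (f i))\<^sup>2 / 2)))"
      using I by (simp add: exp_sum)
    also have "\<dots> = (\<Prod>i\<in>I. CLINT \<omega>|completion P. iexp (a i * X i \<omega>))"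
      using single by (intro prod.cong refl) simp
    finally show "(CLINT \<omega>|completion P. iexp (\<Sum>i\<in>I. a i * X i \<omega>)) = (\<Prod>i\<in>I. CLINT \<omega>|completion P. iexp (a i * X i \<omega>))" .
  qed
qed

section \<open>Backward triangles\<close>

lemma closed_backward_triangle: "closed (backward_triangle x t c)"
proof -
  have "backward_triangle x t c = {z. 0 \<le> snd z} \<inter> {z. snd z \<le> t} \<inter> {z. \<bar>fst z - x\<bar> \<le> c * (t - snd z)}"
    by (auto simp: backward_triangle_def)
  also have "closed \<dots>"
    by (intro closed_Int closed_Collect_le continuous_intros)
  finally show ?thesis .
qed

lemma backward_triangle_subset_half_plane: "backward_triangle x t c \<subseteq> half_plane"
  by (auto simp: backward_triangle_def half_plane_def)

lemma backward_triangle_Int: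
  "backward_triangle x t c \<inter> backward_triangle x t d = backward_triangle x t (min c d)"
proof -
  have "0 \<le> s \<Longrightarrow> s \<le> t \<Longrightarrow> min c d * (t - s) = min (c * (t - s)) (d * (t - s))" for s
    by (simp add: min_mult_distrib_right)
  then show ?thesis
    by (auto simp: backward_triangle_def)
qed

text \<open>The slice at time \<open>s\<close> is an interval of length \<open>2 c (t - s)\<close>.\<close>

lemma emeasure_backward_triangle:
  assumes "0 < c" "0 < t"
  shows "emeasure lborel (backward_triangle x t c) = ennreal (c * t\<^sup>2)"
proof -
  have "backward_triangle x t c \<in> sets borel"
    using closed_backward_triangle by (rule borel_closed)
  then have meas: "backward_triangle x t c \<in> sets (lborel \<Otimes>\<^sub>M lborel)"
    unfolding lborel_prod by simp
  have "emeasure lborel (backward_triangle x t c) = emeasure (lborel \<Otimes>\<^sub>M lborel) (backward_triangle x t c)"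
    by (simp add: lborel_prod)
  also have "\<dots> = (\<integral>\<^sup>+ s. emeasure lborel ((\<lambda>y. (y, s)) -` backward_triangle x t c) \<partial>lborel)"
    by (rule lborel_pair.emeasure_pair_measure_alt2[OF meas])
  also have "\<dots> = (\<integral>\<^sup>+ s. ennreal (2 * c * (t - s)) * indicator {0..t} s \<partial>lborel)"
  proof (intro nn_integral_cong)
    fix s
    have "(\<lambda>y. (y, s)) -` backward_triangle x t c = (if s \<in> {0..t} then {x - c * (t - s) .. x + c * (t - s)} else {})"
      by (auto simp: backward_triangle_def abs_le_iff)
    then show "emeasure lborel ((\<lambda>y. (y, s)) -` backward_triangle x t c) = ennreal (2 * c * (t - s)) * indicator {0..t} s"
      using assms by (auto simp: indicator_def)
  qed
  also have "\<dots> = ennreal ((2 * c * t * t - c * t\<^sup>2) - (2 * c * t * 0 - c * 0\<^sup>2))"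
    by (rule nn_integral_FTC_Icc[where F = "\<lambda>s. 2 * c * t * s - c * s\<^sup>2"])
      (use assms in \<open>auto intro!: derivative_eq_intros simp: algebra_simps\<close>)
  finally show ?thesis
    by (simp add: power2_eq_square algebra_simps)
qed

lemma integral_backward_triangle_product:
  assumes "0 < c" "0 < d" "0 < t"
  shows "(\<integral>z. indicator (backward_triangle x t c) z * indicator (backward_triangle x t d) z \<partial>lebesgue_on half_plane) = min c d * t\<^sup>2"
proof -
  let ?T = "backward_triangle x t (min c d)"
  have meas: "?T \<in> sets lborel"
    using closed_backward_triangle by (auto intro: borel_closed)
  have "(\<integral>z. indicat_real (backward_triangle x t c) z * indicator (backward_triangle x t d) z \<partial>lebesgue_on half_plane)
      = (\<integral>z. indicator ?T z \<partial>lebesgue_on half_plane)"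
    by (intro Bochner_Integration.integral_cong refl) (simp add: backward_triangle_Int[symmetric] indicator_inter_arith)
  also have "\<dots> = (\<integral>z. indicator half_plane z *\<^sub>R indicator ?T z \<partial>lebesgue)"
    using half_plane_sets by (intro integral_restrict_space) simp
  also have "\<dots> = (\<integral>z. indicator ?T z \<partial>lebesgue)"
    using backward_triangle_subset_half_plane[of x t "min c d"]
    by (intro Bochner_Integration.integral_cong) (auto simp: indicator_def)
  also have "\<dots> = measure lborel ?T"
    using meas by simp
  also have "\<dots> = min c d * t\<^sup>2"
    using emeasure_backward_triangle[of "min c d" t x] assms by (simp add: measure_def)
  finally show ?thesis .
qed

section \<open>Continuity at time zero\<close>

text \<open>Let \<open>A\<^sub>k\<close> be the event that the partial sums \<open>S\<close> reach the level \<open>\<epsilon>\<close> at time \<open>k\<close> for the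
  first time. On \<open>A\<^sub>k\<close> write \<open>S\<^sub>n = S\<^sub>k + D\<close>. The variable \<open>1(A\<^sub>k) S\<^sub>k\<close> depends on the past alone and is
  independent of the centred variable \<open>D\<close>, so the mixed term of \<open>(S\<^sub>k + D)\<^sup>2\<close> has expectation \<open>0\<close> and
  \<open>E (1(A\<^sub>k) S\<^sub>n\<^sup>2) \<ge> \<epsilon>\<^sup>2 P(A\<^sub>k)\<close>. The events \<open>A\<^sub>k\<close> are disjoint, and the estimates add up.\<close>

lemma (in prob_space) Kolmogorov_maximal_inequality:
  fixes X :: "nat \<Rightarrow> 'a \<Rightarrow> real"
  assumes indep: "indep_vars (\<lambda>_. borel) X {..<n}"
    and sq: "\<And>i. i < n \<Longrightarrow> square_integrable M (X i)"
    and mean: "\<And>i. i < n \<Longrightarrow> expectation (X i) = 0"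
    and \<epsilon>: "\<epsilon> > 0"
  shows "\<epsilon>\<^sup>2 * prob {\<omega> \<in> space M. \<exists>k\<le>n. \<epsilon> \<le> \<bar>\<Sum>i<k. X i \<omega>\<bar>} \<le> expectation (\<lambda>\<omega>. (\<Sum>i<n. X i \<omega>)\<^sup>2)"
proof -
  define S where "S k \<omega> = (\<Sum>i<k. X i \<omega>)" for k \<omega>
  have S_sq: "square_integrable M (S k)" if "k \<le> n" for k
    unfolding S_def[abs_def] using that sq by (intro square_integrable_sum) auto
  then have S_meas [measurable]: "S k \<in> borel_measurable M" if "k \<le> n" for k
    using that by (simp add: square_integrable_def)
  define A where "A k = {\<omega> \<in> space M. \<epsilon> \<le> \<bar>S k \<omega>\<bar> \<and> (\<forall>j\<in>{..<k}. \<bar>S j \<omega>\<bar> < \<epsilon>)}" for k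
  have A_meas: "A k \<in> events" if "k \<le> n" for k
  proof -
    have "{\<omega> \<in> space M. \<epsilon> \<le> \<bar>S k \<omega>\<bar>} \<in> events"
      using that by measurable
    moreover have "{\<omega> \<in> space M. \<bar>S j \<omega>\<bar> < \<epsilon>} \<in> events" if "j < k" for j
    proof -
      have [measurable]: "S j \<in> borel_measurable M"
        using that \<open>k \<le> n\<close> by simp
      show ?thesis by measurable
    qed
    then have "{\<omega> \<in> space M. \<forall>j\<in>{..<k}. \<bar>S j \<omega>\<bar> < \<epsilon>} \<in> events"
      by (intro sets.sets_Collect_finite_All) auto
    ultimately show ?thesis
      unfolding A_def by (intro sets.sets_Collect_conj)
  qed
  have disj: "disjoint_family_on A {..n}"
  proof -
    have "A j \<inter> A k = {}" if "j < k" for j k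
      using that by (force simp: A_def)
    then show ?thesis
      unfolding disjoint_family_on_def by (metis inf_commute linorder_neqE_nat)
  qed
  have union: "{\<omega> \<in> space M. \<exists>k\<le>n. \<epsilon> \<le> \<bar>S k \<omega>\<bar>} = (\<Union>k\<le>n. A k)"
  proof (intro set_eqI iffI)
    fix \<omega> assume \<omega>: "\<omega> \<in> {\<omega> \<in> space M. \<exists>k\<le>n. \<epsilon> \<le> \<bar>S k \<omega>\<bar>}"
    then obtain k where k: "k \<le> n" "\<epsilon> \<le> \<bar>S k \<omega>\<bar>" by auto
    define l where "l = (LEAST k. \<epsilon> \<le> \<bar>S k \<omega>\<bar>)"
    have "\<epsilon> \<le> \<bar>S l \<omega>\<bar>" "l \<le> k"
      using k(2) unfolding l_def by (auto intro: LeastI Least_le)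
    moreover have "\<bar>S j \<omega>\<bar> < \<epsilon>" if "j < l" for j
      using not_less_Least[of j "\<lambda>k. \<epsilon> \<le> \<bar>S k \<omega>\<bar>"] that by (simp add: l_def)
    ultimately show "\<omega> \<in> (\<Union>k\<le>n. A k)"
      using \<omega> k(1) by (auto simp: A_def intro!: bexI[of _ l])
  qed (auto simp: A_def)
  have part: "\<epsilon>\<^sup>2 * prob (A k) \<le> expectation (\<lambda>\<omega>. indicator (A k) \<omega> * (S n \<omega>)\<^sup>2)"
    and part_int: "integrable M (\<lambda>\<omega>. indicator (A k) \<omega> * (S n \<omega>)\<^sup>2)" if k: "k \<le> n" for k
  proof -
    define D where "D \<omega> = (\<Sum>i\<in>{k..<n}. X i \<omega>)" for \<omega>
    \<comment> \<open>\<open>1(A\<^sub>k) S\<^sub>k\<close> as a function of the first \<open>k\<close> summands, in a form whose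
      measurability on the product space can be read off\<close>
    define past :: "(nat \<Rightarrow> real) \<Rightarrow> real" where
      "past f = (\<Sum>i<k. f i) * (indicator {\<epsilon>..} \<bar>\<Sum>i<k. f i\<bar> * (\<Prod>j<k. indicator {..<\<epsilon>} \<bar>\<Sum>i<j. f i\<bar>))" for f
    let ?R1 = "\<lambda>\<omega>. restrict (\<lambda>i. X i \<omega>) {..<k}" and ?R2 = "\<lambda>\<omega>. restrict (\<lambda>i. X i \<omega>) {k..<n}"
    have sums: "(\<lambda>f. \<Sum>i<j. f i) \<in> borel_measurable (PiM {..<k} (\<lambda>_. borel :: real measure))" if "j \<le> k" for j
      by (rule borel_measurable_sum, rule measurable_component_singleton) (use that in auto)
    have "past \<in> borel_measurable (PiM {..<k} (\<lambda>_. borel))"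
      unfolding past_def[abs_def]
    proof (intro borel_measurable_times borel_measurable_prod)
      show "(\<lambda>f. indicator {\<epsilon>..} \<bar>\<Sum>i<k. f i\<bar> :: real) \<in> borel_measurable (PiM {..<k} (\<lambda>_. borel))"
        by (rule measurable_compose[OF sums, of _ "\<lambda>y. indicator {\<epsilon>..} \<bar>y\<bar>"]) simp_all
      fix j assume "j \<in> {..<k}"
      then show "(\<lambda>f. indicator {..<\<epsilon>} \<bar>\<Sum>i<j. f i\<bar> :: real) \<in> borel_measurable (PiM {..<k} (\<lambda>_. borel))"
        by (intro measurable_compose[OF sums, of _ "\<lambda>y. indicator {..<\<epsilon>} \<bar>y\<bar>"]) simp_all
    qed (simp add: sums)
    moreover have "(\<lambda>f. \<Sum>i\<in>{k..<n}. f i) \<in> borel_measurable (PiM {k..<n} (\<lambda>_. borel :: real measure))"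
      by (intro borel_measurable_sum measurable_component_singleton)
    moreover have "indep_var (PiM {..<k} (\<lambda>_. borel)) ?R1 (PiM {k..<n} (\<lambda>_. borel)) ?R2"
      using k by (intro indep_var_restrict[OF indep]) auto
    ultimately have "indep_var borel (past \<circ> ?R1) borel ((\<lambda>f. \<Sum>i\<in>{k..<n}. f i) \<circ> ?R2)"
      by (intro indep_var_compose)
    moreover have "(\<lambda>f. \<Sum>i\<in>{k..<n}. f i) \<circ> ?R2 = D"
      by (auto simp: D_def)
    moreover have past_eq: "(past \<circ> ?R1) \<omega> = indicator (A k) \<omega> * S k \<omega>" if "\<omega> \<in> space M" for \<omega>
    proof -
      have R: "(\<Sum>i<j. ?R1 \<omega> i) = S j \<omega>" if "j \<le> k" for j
        unfolding S_def using that by (intro sum.cong) auto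
      have "(\<Prod>j<k. indicator {..<\<epsilon>} \<bar>\<Sum>i<j. ?R1 \<omega> i\<bar>) = (\<Prod>j<k. indicator {..<\<epsilon>} \<bar>S j \<omega>\<bar> :: real)"
        using R by (intro prod.cong) auto
      moreover have "indicator (A k) \<omega> = (indicator {\<epsilon>..} \<bar>S k \<omega>\<bar> * (\<Prod>j<k. indicator {..<\<epsilon>} \<bar>S j \<omega>\<bar>) :: real)"
        using that by (auto simp: A_def indicator_def prod_zero_iff intro!: prod.neutral)
      ultimately show ?thesis
        using R[of k] by (simp add: past_def)
    qed
    ultimately have ind: "indep_var borel (past \<circ> ?R1) borel D"
      by simp
    have int_past: "integrable M (past \<circ> ?R1)"
    proof -
      have "integrable M (S k)"
        using S_sq[OF k] by (auto simp: square_integrable_def intro: square_integrable_imp_integrable)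
      then have "integrable M (\<lambda>\<omega>. indicator (A k) \<omega> *\<^sub>R S k \<omega>)"
        by (rule integrable_mult_indicator[OF A_meas[OF k]])
      then show ?thesis
        by (subst Bochner_Integration.integrable_cong[OF refl past_eq]) auto
    qed
    have X_int: "integrable M (X i)" if "i < n" for i
      using sq[OF that] by (auto simp: square_integrable_def intro: square_integrable_imp_integrable)
    have int_D: "integrable M D"
      unfolding D_def[abs_def] using X_int by (intro Bochner_Integration.integrable_sum) auto
    have "expectation D = 0"
      unfolding D_def using X_int mean by (subst Bochner_Integration.integral_sum) auto
    then have "expectation (\<lambda>\<omega>. (past \<circ> ?R1) \<omega> * D \<omega>) = 0"
      using indep_var_lebesgue_integral[OF ind int_past int_D] by simp
    then have cross: "expectation (\<lambda>\<omega>. indicator (A k) \<omega> * S k \<omega> * D \<omega>) = 0"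
      by (subst (asm) Bochner_Integration.integral_cong[OF refl, where g = "\<lambda>\<omega>. indicator (A k) \<omega> * S k \<omega> * D \<omega>"])
        (simp_all add: past_eq del: comp_apply)
    have cross_int: "integrable M (\<lambda>\<omega>. indicator (A k) \<omega> * S k \<omega> * D \<omega>)"
      using indep_var_integrable[OF ind int_past int_D]
      by (subst (asm) Bochner_Integration.integrable_cong[OF refl, where g = "\<lambda>\<omega>. indicator (A k) \<omega> * S k \<omega> * D \<omega>"])
        (simp_all add: past_eq del: comp_apply)
    have "integrable M (\<lambda>\<omega>. indicator (A k) \<omega> *\<^sub>R (S n \<omega>)\<^sup>2)"
      using S_sq[of n] A_meas[OF k] by (intro integrable_mult_indicator) (auto simp: square_integrable_def)
    then show int: "integrable M (\<lambda>\<omega>. indicator (A k) \<omega> * (S n \<omega>)\<^sup>2)"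
      by simp
    have int_ind: "integrable M (\<lambda>\<omega>. \<epsilon>\<^sup>2 * indicator (A k) \<omega>)"
      using A_meas[OF k] by (auto simp: emeasure_eq_measure)
    have "\<epsilon>\<^sup>2 * prob (A k) = expectation (\<lambda>\<omega>. \<epsilon>\<^sup>2 * indicator (A k) \<omega> + 2 * (indicator (A k) \<omega> * S k \<omega> * D \<omega>))"
      using int_ind cross_int cross A_meas[OF k] sets.sets_into_space[OF A_meas[OF k]]
      by (simp add: Int_absorb2)
    also have "\<dots> \<le> expectation (\<lambda>\<omega>. indicator (A k) \<omega> * (S n \<omega>)\<^sup>2)"
    proof (rule integral_mono)
      fix \<omega> assume \<omega>: "\<omega> \<in> space M"
      have "S n \<omega> = S k \<omega> + D \<omega>"
        unfolding S_def D_def using k by (metis atLeast0LessThan sum.atLeastLessThan_concat zero_le)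
      then have "(S n \<omega>)\<^sup>2 = (S k \<omega>)\<^sup>2 + 2 * (S k \<omega> * D \<omega>) + (D \<omega>)\<^sup>2"
        by (simp add: power2_sum)
      moreover have "\<epsilon>\<^sup>2 \<le> (S k \<omega>)\<^sup>2" if "\<omega> \<in> A k"
        using that \<epsilon> power_mono[of \<epsilon> "\<bar>S k \<omega>\<bar>" 2] by (simp add: A_def)
      ultimately show "\<epsilon>\<^sup>2 * indicator (A k) \<omega> + 2 * (indicator (A k) \<omega> * S k \<omega> * D \<omega>) \<le> indicator (A k) \<omega> * (S n \<omega>)\<^sup>2"
        by (auto split: split_indicator intro: add_increasing2)
    qed (use int_ind cross_int int in auto)
    finally show "\<epsilon>\<^sup>2 * prob (A k) \<le> expectation (\<lambda>\<omega>. indicator (A k) \<omega> * (S n \<omega>)\<^sup>2)" .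
  qed
  have "\<epsilon>\<^sup>2 * prob (\<Union>k\<le>n. A k) = (\<Sum>k\<le>n. \<epsilon>\<^sup>2 * prob (A k))"
    using disj A_meas by (subst finite_measure_finite_Union) (auto simp: sum_distrib_left)
  also have "\<dots> \<le> (\<Sum>k\<le>n. expectation (\<lambda>\<omega>. indicator (A k) \<omega> * (S n \<omega>)\<^sup>2))"
    using part by (intro sum_mono) auto
  also have "\<dots> = expectation (\<lambda>\<omega>. \<Sum>k\<le>n. indicator (A k) \<omega> * (S n \<omega>)\<^sup>2)"
    using part_int by (subst Bochner_Integration.integral_sum) auto
  also have "\<dots> \<le> expectation (\<lambda>\<omega>. (S n \<omega>)\<^sup>2)"
  proof (rule integral_mono)
    show "integrable M (\<lambda>\<omega>. \<Sum>k\<le>n. indicator (A k) \<omega> * (S n \<omega>)\<^sup>2)"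
      using part_int by (intro Bochner_Integration.integrable_sum) auto
    show "integrable M (\<lambda>\<omega>. (S n \<omega>)\<^sup>2)"
      using S_sq[of n] by (simp add: square_integrable_def)
    fix \<omega>
    have "(\<Sum>k\<le>n. indicator (A k) \<omega> * (S n \<omega>)\<^sup>2) = indicator (\<Union>k\<le>n. A k) \<omega> * (S n \<omega>)\<^sup>2"
      using disj by (simp add: indicator_UN_disjoint sum_distrib_right)
    also have "\<dots> \<le> (S n \<omega>)\<^sup>2"
      by (auto split: split_indicator)
    finally show "(\<Sum>k\<le>n. indicator (A k) \<omega> * (S n \<omega>)\<^sup>2) \<le> (S n \<omega>)\<^sup>2" .
  qed
  finally show ?thesis
    unfolding union[symmetric] unfolding S_def .
qed

lemma dyadic_floor_tendsto: "(\<lambda>m. real (nat \<lfloor>x * 2 ^ m\<rfloor>) / 2 ^ m) \<longlonglongrightarrow> x" if "0 \<le> x"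
proof (rule Lim_transform2[OF tendsto_const], rule Lim_null_comparison)
  show "(\<lambda>m. (1 / 2) ^ m) \<longlonglongrightarrow> (0::real)"
    by (rule LIMSEQ_power_zero) simp
  have "\<bar>x - real (nat \<lfloor>x * 2 ^ m\<rfloor>) / 2 ^ m\<bar> \<le> (1 / 2) ^ m" for m
  proof -
    have "real (nat \<lfloor>x * 2 ^ m\<rfloor>) = of_int \<lfloor>x * 2 ^ m\<rfloor>"
      using that by (subst of_nat_nat) auto
    then have "\<bar>x * 2 ^ m - real (nat \<lfloor>x * 2 ^ m\<rfloor>)\<bar> \<le> 1"
      by linarith
    then have "\<bar>x * 2 ^ m - real (nat \<lfloor>x * 2 ^ m\<rfloor>)\<bar> / 2 ^ m \<le> 1 / 2 ^ m"
      by (intro divide_right_mono) auto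
    moreover have "\<bar>x * 2 ^ m - real (nat \<lfloor>x * 2 ^ m\<rfloor>)\<bar> / 2 ^ m = \<bar>x - real (nat \<lfloor>x * 2 ^ m\<rfloor>) / 2 ^ m\<bar>"
      by (subst abs_div_pos) (simp_all add: diff_divide_distrib)
    ultimately show ?thesis
      by (simp add: power_one_over)
  qed
  then show "\<forall>\<^sub>F m in sequentially. norm (x - real (nat \<lfloor>x * 2 ^ m\<rfloor>) / 2 ^ m) \<le> (1 / 2) ^ m"
    by simp
qed

text \<open>Let \<open>U \<delta> \<epsilon>\<close> be the event that \<open>\<bar>B\<bar> \<ge> \<epsilon>\<close> at some dyadic multiple of \<open>\<delta>\<close> in \<open>[0, \<delta>]\<close>.
  It is the increasing union of the corresponding events \<open>G \<delta> \<epsilon> m\<close> on finite grids, so the maximal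
  inequality bounds its probability by \<open>\<delta> / \<epsilon>\<^sup>2\<close>. This tends to \<open>0\<close> with \<open>\<delta>\<close>; hence for each \<open>\<epsilon>\<close> almost
  every outcome avoids \<open>U \<delta> \<epsilon>\<close> for some \<open>\<delta>\<close>, and continuity at positive times extends the bound from dyadic
  to all times in \<open>(0, \<delta>]\<close>.\<close>

lemma (in prob_space) AE_continuous_at_zero:
  fixes B :: "real \<Rightarrow> 'a \<Rightarrow> real"
  assumes zero: "\<And>\<omega>. B 0 \<omega> = 0"
    and sq: "\<And>r. 0 \<le> r \<Longrightarrow> square_integrable M (B r)"
    and indep: "\<And>(\<tau> :: nat \<Rightarrow> real) n. 0 \<le> \<tau> 0 \<Longrightarrow> (\<And>i. i < n \<Longrightarrow> \<tau> i < \<tau> (Suc i)) \<Longrightarrow>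
      indep_vars (\<lambda>_. borel) (\<lambda>i \<omega>. B (\<tau> (Suc i)) \<omega> - B (\<tau> i) \<omega>) {..<n}"
    and mean: "\<And>r. 0 \<le> r \<Longrightarrow> expectation (B r) = 0"
    and var: "\<And>r. 0 \<le> r \<Longrightarrow> expectation (\<lambda>\<omega>. (B r \<omega>)\<^sup>2) = r"
    and cont: "AE \<omega> in M. continuous_on {0<..} (\<lambda>r. B r \<omega>)"
  shows "AE \<omega> in M. continuous_on {0..} (\<lambda>r. B r \<omega>)"
proof -
  have [measurable]: "B r \<in> borel_measurable M" if "0 \<le> r" for r
    using sq[OF that] by (simp add: square_integrable_def)
  define G where "G \<delta> \<epsilon> m = {\<omega> \<in> space M. \<exists>k\<le>2 ^ m. \<epsilon> \<le> \<bar>B (\<delta> * (real k / 2 ^ m)) \<omega>\<bar>}" for \<delta> \<epsilon> :: real and m :: nat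
  have G_meas: "G \<delta> \<epsilon> m \<in> events" if "0 < \<delta>" for \<delta> \<epsilon> m
  proof -
    have [measurable]: "B (\<delta> * (real k / 2 ^ m)) \<in> borel_measurable M" for k
      using that by simp
    have "G \<delta> \<epsilon> m = (\<Union>k\<le>2 ^ m. {\<omega> \<in> space M. \<epsilon> \<le> \<bar>B (\<delta> * (real k / 2 ^ m)) \<omega>\<bar>})"
      by (auto simp: G_def)
    moreover have "{\<omega> \<in> space M. \<epsilon> \<le> \<bar>B (\<delta> * (real k / 2 ^ m)) \<omega>\<bar>} \<in> events" for k
      by measurable
    ultimately show ?thesis by (auto intro!: sets.finite_UN)
  qed
  have G_prob: "prob (G \<delta> \<epsilon> m) \<le> \<delta> / \<epsilon>\<^sup>2" if \<delta>: "0 < \<delta>" and \<epsilon>: "0 < \<epsilon>" for \<delta> \<epsilon> m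
  proof -
    define \<tau> where "\<tau> k = \<delta> * (real k / 2 ^ m)" for k :: nat
    have \<tau>: "0 \<le> \<tau> 0" "0 \<le> \<tau> i" "\<tau> i < \<tau> (Suc i)" for i
      using \<delta> by (auto simp: \<tau>_def divide_strict_right_mono)
    have [simp]: "\<tau> (2 ^ m) = \<delta>" by (simp add: \<tau>_def)
    let ?X = "\<lambda>i \<omega>. B (\<tau> (Suc i)) \<omega> - B (\<tau> i) \<omega>"
    have tele: "(\<Sum>i<k. ?X i \<omega>) = B (\<tau> k) \<omega>" for k \<omega>
      using zero by (induction k) (simp_all add: \<tau>_def)
    have "\<epsilon>\<^sup>2 * prob {\<omega> \<in> space M. \<exists>k\<le>2 ^ m. \<epsilon> \<le> \<bar>\<Sum>i<k. ?X i \<omega>\<bar>} \<le> expectation (\<lambda>\<omega>. (\<Sum>i<2 ^ m. ?X i \<omega>)\<^sup>2)"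
    proof (rule Kolmogorov_maximal_inequality)
      show "indep_vars (\<lambda>_. borel) ?X {..<2 ^ m}"
        using \<tau> by (intro indep) auto
      fix i
      show "square_integrable M (?X i)"
        using \<tau> by (intro square_integrable_diff sq) auto
      have "integrable M (B (\<tau> j))" for j
        using sq[OF \<tau>(2)] by (auto simp: square_integrable_def intro: square_integrable_imp_integrable)
      then show "expectation (?X i) = 0"
        using mean \<tau> by simp
    qed fact
    then have "\<epsilon>\<^sup>2 * prob (G \<delta> \<epsilon> m) \<le> \<delta>"
      unfolding tele using var[of \<delta>] \<delta> by (simp add: G_def \<tau>_def)
    then show ?thesis
      using \<epsilon> by (simp add: pos_le_divide_eq mult.commute)
  qed
  have G_inc: "incseq (G \<delta> \<epsilon>)" for \<delta> \<epsilon>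
  proof (rule incseq_SucI, rule subsetI)
    fix m \<omega> assume "\<omega> \<in> G \<delta> \<epsilon> m"
    then obtain k where k: "\<omega> \<in> space M" "k \<le> 2 ^ m" "\<epsilon> \<le> \<bar>B (\<delta> * (real k / 2 ^ m)) \<omega>\<bar>"
      by (auto simp: G_def)
    \<comment> \<open>the grid point \<open>k\<close> is the point \<open>2 k\<close> of the next finer grid\<close>
    then have "2 * k \<le> 2 ^ Suc m" "\<epsilon> \<le> \<bar>B (\<delta> * (real (2 * k) / 2 ^ Suc m)) \<omega>\<bar>"
      by auto
    then show "\<omega> \<in> G \<delta> \<epsilon> (Suc m)"
      using k(1) unfolding G_def by blast
  qed
  define U where "U \<delta> \<epsilon> = (\<Union>m. G \<delta> \<epsilon> m)" for \<delta> \<epsilon>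
  have U_meas: "U \<delta> \<epsilon> \<in> events" if "0 < \<delta>" for \<delta> \<epsilon>
    unfolding U_def using G_meas[OF that] by auto
  have U_prob: "prob (U \<delta> \<epsilon>) \<le> \<delta> / \<epsilon>\<^sup>2" if "0 < \<delta>" "0 < \<epsilon>" for \<delta> \<epsilon>
  proof (rule LIMSEQ_le_const2)
    show "(\<lambda>m. prob (G \<delta> \<epsilon> m)) \<longlonglongrightarrow> prob (U \<delta> \<epsilon>)"
      unfolding U_def using G_meas[OF that(1)] G_inc by (intro finite_Lim_measure_incseq) auto
  qed (use G_prob[OF that] in auto)
  have U_path: "\<bar>B r \<omega>\<bar> \<le> \<epsilon>"
    if \<omega>: "\<omega> \<in> space M" "\<omega> \<notin> U \<delta> \<epsilon>" "continuous_on {0<..} (\<lambda>r. B r \<omega>)" and r: "0 < r" "r \<le> \<delta>" for \<omega> \<delta> \<epsilon> r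
  proof -
    have \<delta>: "0 < \<delta>" using r by simp
    define q where "q m = nat \<lfloor>r / \<delta> * 2 ^ m\<rfloor>" for m :: nat
    have q_le: "q m \<le> 2 ^ m" for m
    proof -
      have "r / \<delta> * 2 ^ m \<le> 1 * 2 ^ m"
        using r \<delta> by (intro mult_right_mono) auto
      then have "\<lfloor>r / \<delta> * 2 ^ m\<rfloor> \<le> \<lfloor>2 ^ m :: real\<rfloor>"
        by (intro floor_mono) simp
      also have "\<lfloor>2 ^ m :: real\<rfloor> = 2 ^ m"
        by (metis floor_of_int of_int_numeral of_int_power)
      finally show ?thesis
        by (simp add: q_def nat_le_iff)
    qed
    have "(\<lambda>m. \<delta> * (real (q m) / 2 ^ m)) \<longlonglongrightarrow> \<delta> * (r / \<delta>)"
      unfolding q_def using r \<delta> by (intro tendsto_mult_left dyadic_floor_tendsto) simp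
    then have lim: "(\<lambda>m. \<delta> * (real (q m) / 2 ^ m)) \<longlonglongrightarrow> r"
      using \<delta> by simp
    then have "\<forall>\<^sub>F m in sequentially. 0 < \<delta> * (real (q m) / 2 ^ m)"
      using r(1) by (rule order_tendstoD)
    then have "(\<lambda>m. B (\<delta> * (real (q m) / 2 ^ m)) \<omega>) \<longlonglongrightarrow> B r \<omega>"
      using r(1) by (intro continuous_on_tendsto_compose[OF \<omega>(3) lim]) auto
    then have "(\<lambda>m. \<bar>B (\<delta> * (real (q m) / 2 ^ m)) \<omega>\<bar>) \<longlonglongrightarrow> \<bar>B r \<omega>\<bar>"
      by (rule tendsto_rabs)
    moreover have "\<bar>B (\<delta> * (real (q m) / 2 ^ m)) \<omega>\<bar> \<le> \<epsilon>" for m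
      using \<omega>(1,2) q_le[of m] by (force simp: U_def G_def)
    ultimately show ?thesis
      by (intro LIMSEQ_le_const2) auto
  qed
  have "AE \<omega> in M. \<exists>i. \<omega> \<notin> U (1 / real (Suc i)) (1 / real (Suc j))" for j
  proof -
    let ?N = "\<Inter>i. U (1 / real (Suc i)) (1 / real (Suc j))"
    have N_meas: "?N \<in> events"
      using U_meas by (intro sets.countable_INT) auto
    have "prob ?N \<le> 0"
    proof (rule LIMSEQ_le_const)
      have "(\<lambda>i. inverse (real (Suc i)) / (1 / real (Suc j))\<^sup>2) \<longlonglongrightarrow> 0 / (1 / real (Suc j))\<^sup>2"
        by (intro tendsto_divide LIMSEQ_inverse_real_of_nat tendsto_const) auto
      then show "(\<lambda>i. (1 / real (Suc i)) / (1 / real (Suc j))\<^sup>2) \<longlonglongrightarrow> 0"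
        by (simp add: divide_inverse)
      have "prob ?N \<le> (1 / real (Suc i)) / (1 / real (Suc j))\<^sup>2" for i
        using finite_measure_mono[of ?N "U (1 / real (Suc i)) (1 / real (Suc j))"]
          U_prob[of "1 / real (Suc i)" "1 / real (Suc j)"] U_meas[of "1 / real (Suc i)"]
        by (meson INT_lower UNIV_I divide_pos_pos of_nat_0_less_iff order_trans zero_less_Suc zero_less_one)
      then show "\<exists>N. \<forall>i\<ge>N. prob ?N \<le> (1 / real (Suc i)) / (1 / real (Suc j))\<^sup>2"
        by blast
    qed
    then have "prob ?N = 0"
      using measure_nonneg[of M ?N] by linarith
    then have "?N \<in> null_sets M"
      using N_meas by (auto simp: emeasure_eq_measure)
    then have "AE \<omega> in M. \<omega> \<notin> ?N"
      by (rule AE_not_in)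
    then show ?thesis
      by simp
  qed
  then have "AE \<omega> in M. \<forall>j. \<exists>i. \<omega> \<notin> U (1 / real (Suc i)) (1 / real (Suc j))"
    by (simp add: AE_all_countable)
  with cont AE_space show ?thesis
  proof eventually_elim
    fix \<omega> assume \<omega>: "continuous_on {0<..} (\<lambda>r. B r \<omega>)" "\<omega> \<in> space M"
      and small: "\<forall>j. \<exists>i. \<omega> \<notin> U (1 / real (Suc i)) (1 / real (Suc j))"
    show "continuous_on {0..} (\<lambda>r. B r \<omega>)"
      unfolding continuous_on_iff
    proof (intro ballI allI impI)
      fix r e :: real assume r: "r \<in> {0..}" and e: "0 < e"
      show "\<exists>d>0. \<forall>s\<in>{0..}. dist s r < d \<longrightarrow> dist (B s \<omega>) (B r \<omega>) < e"
      proof (cases "r = 0")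
        case True
        obtain j where j: "1 / real (Suc j) < e"
          using reals_Archimedean[OF e] by (auto simp: inverse_eq_divide)
        obtain i where i: "\<omega> \<notin> U (1 / real (Suc i)) (1 / real (Suc j))"
          using small by blast
        show ?thesis
        proof (intro exI[of _ "1 / real (Suc i)"] conjI ballI impI)
          fix s :: real assume s: "s \<in> {0..}" "dist s r < 1 / real (Suc i)"
          show "dist (B s \<omega>) (B r \<omega>) < e"
          proof (cases "s = 0")
            case False
            then have "\<bar>B s \<omega>\<bar> \<le> 1 / real (Suc j)"
              using s True by (intro U_path[OF \<omega>(2) i \<omega>(1)]) (auto simp: dist_real_def)
            then show ?thesis
              using j True zero by (simp add: dist_real_def)
          qed (use True e in simp)
        qed simp
      next
        case False
        then have "0 < r" using r by simp
        then obtain d where d: "d > 0" "\<And>s. s > 0 \<Longrightarrow> dist s r < d \<Longrightarrow> dist (B s \<omega>) (B r \<omega>) < e"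
          using \<omega>(1) e unfolding continuous_on_iff by (metis greaterThan_iff)
        show ?thesis
          using d \<open>0 < r\<close> by (intro exI[of _ "min d r"]) (auto simp: dist_real_def)
      qed
    qed
  qed
qed

section \<open>The time-changed solution\<close>

text \<open>This is the integrand \<open>g\<^sub>r\<close> of the process: \<open>2 / t\<close> times \<open>1 / (2 c)\<close> times the indicator of the
  triangle, with \<open>c = 1 / r\<close>.\<close>

definition normalized_triangle :: "real \<Rightarrow> real \<Rightarrow> real \<Rightarrow> real \<times> real \<Rightarrow> real" where
  "normalized_triangle x t r z = (if r > 0 then r / t * indicator (backward_triangle x t (1 / r)) z else 0)"

lemma integral_normalized_triangle_product:
  assumes t: "0 < t" and r: "0 \<le> r" and s: "0 \<le> s"
  shows "(\<integral>z. normalized_triangle x t r z * normalized_triangle x t s z \<partial>lebesgue_on half_plane) = min r s"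
proof (cases "r = 0 \<or> s = 0")
  case True
  then show ?thesis
    using r s by (auto simp: normalized_triangle_def)
next
  case False
  then have pos: "0 < r" "0 < s"
    using r s by auto
  have "(\<integral>z. normalized_triangle x t r z * normalized_triangle x t s z \<partial>lebesgue_on half_plane)
      = (\<integral>z. (r * s / t\<^sup>2) * (indicator (backward_triangle x t (1 / r)) z * indicator (backward_triangle x t (1 / s)) z)
          \<partial>lebesgue_on half_plane)"
    using pos by (intro Bochner_Integration.integral_cong refl) (simp add: normalized_triangle_def power2_eq_square)
  also have "\<dots> = (r * s / t\<^sup>2) * (min (1 / r) (1 / s) * t\<^sup>2)"
    using integral_backward_triangle_product[of "1 / r" "1 / s" t x] pos t by simp
  also have "\<dots> = min r s"
    using pos t by (cases "r \<le> s") (simp_all add: min_def field_simps)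
  finally show ?thesis .
qed

theorem proposition4p2:
  fixes P :: "((real \<times> real \<Rightarrow> real) \<Rightarrow> real) measure"
    and x t :: real
    and u :: "real \<Rightarrow> ((real \<times> real \<Rightarrow> real) \<Rightarrow> real) \<Rightarrow> real"
  assumes "white_noise_measure P"
    and "t > 0"
    and "\<And>c. c > 0 \<Longrightarrow>
      white_noise_version P (\<lambda>z. 1 / (2 * c) * indicator (backward_triangle x t c) z) (u c)"
    and "AE \<omega> in completion P. continuous_on {0<..} (\<lambda>c. u c \<omega>)"
  shows "brownian_motion (completion P)
    (\<lambda>r \<omega>. if r > 0 then 2 / t * u (1 / r) \<omega> else 0)"
proof -
  note P = assms(1) and t = assms(2)
  interpret prob_space "completion P"
    by (rule prob_space_white_noise[OF P])
  let ?H = "lebesgue_on half_plane"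
  let ?g = "normalized_triangle x t"
  define B where "B r \<omega> = (if r > 0 then 2 / t * u (1 / r) \<omega> else 0)" for r \<omega>
  have version: "white_noise_version P (?g r) (B r)" if "0 \<le> r" for r
  proof (cases "r = 0")
    case True
    then show ?thesis
      using white_noise_version_zero[OF P] by (simp add: B_def[abs_def] normalized_triangle_def[abs_def])
  next
    case False
    then have "0 < 1 / r" "0 < r" using that by auto
    from white_noise_version_linear[OF P assms(3) assms(3), OF this(1) this(1), of "2 / t" 0]
    show ?thesis
      using \<open>0 < r\<close> by (simp add: B_def[abs_def] normalized_triangle_def[abs_def])
  qed
  have version_diff: "white_noise_version P (\<lambda>z. ?g s z - ?g r z) (\<lambda>\<omega>. B s \<omega> - B r \<omega>)" if "0 \<le> r" "0 \<le> s" for r s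
    using white_noise_version_linear[OF P version[OF that(2)] version[OF that(1)], of 1 "- 1"] by simp
  have sq: "square_integrable ?H (?g r)" if "0 \<le> r" for r
    using version[OF that] by (auto simp: white_noise_version_def intro: square_integrable_half_plane)
  \<comment> \<open>bilinear expansion of \<open>\<langle>g\<^sub>r, g\<^sub>s\<rangle> = min r s\<close>; over disjoint intervals the four
    terms cancel, over the same interval they leave its length\<close>
  have inner: "(\<integral>z. (?g s z - ?g r z) * (?g s' z - ?g r' z) \<partial>?H) = min s s' - min s r' - min r s' + min r r'"
    if "0 \<le> r" "0 \<le> s" "0 \<le> r'" "0 \<le> s'" for r s r' s'
  proof -
    have int: "integrable ?H (\<lambda>z. ?g p z * ?g q z)" if "0 \<le> p" "0 \<le> q" for p q
      using that by (intro square_integrable_integrable_mult sq)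
    have "(\<integral>z. (?g s z - ?g r z) * (?g s' z - ?g r' z) \<partial>?H)
        = (\<integral>z. ?g s z * ?g s' z - ?g s z * ?g r' z - ?g r z * ?g s' z + ?g r z * ?g r' z \<partial>?H)"
      by (simp add: algebra_simps)
    also have "\<dots> = min s s' - min s r' - min r s' + min r r'"
      using that by (simp add: int integral_normalized_triangle_product[OF t])
    finally show ?thesis .
  qed
  have indep: "indep_vars (\<lambda>_. borel) (\<lambda>i \<omega>. B (\<tau> (Suc i)) \<omega> - B (\<tau> i) \<omega>) {..<n}"
    if \<tau>: "0 \<le> \<tau> 0" "\<And>i. i < n \<Longrightarrow> \<tau> i < \<tau> (Suc i)" for \<tau> :: "nat \<Rightarrow> real" and n
  proof -
    have mono: "\<tau> i \<le> \<tau> j" if "i \<le> j" "j \<le> n" for i j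
      using that
    proof (induction j rule: dec_induct)
      case (step j)
      then show ?case using \<tau>(2)[of j] by simp
    qed simp
    have nonneg: "0 \<le> \<tau> i" if "i \<le> n" for i
      using mono[of 0 i] \<tau>(1) that by simp
    show ?thesis
    proof (rule white_noise_version_indep[OF P])
      show "white_noise_version P (\<lambda>z. ?g (\<tau> (Suc i)) z - ?g (\<tau> i) z) (\<lambda>\<omega>. B (\<tau> (Suc i)) \<omega> - B (\<tau> i) \<omega>)"
        if "i \<in> {..<n}" for i
        using that by (intro version_diff nonneg) auto
      fix i j assume ij: "i \<in> {..<n}" "j \<in> {..<n}" "i \<noteq> j"
      have "\<tau> i \<le> \<tau> (Suc i)" "\<tau> j \<le> \<tau> (Suc j)"
        using ij by (auto intro: mono)
      moreover have "\<tau> (Suc i) \<le> \<tau> j \<or> \<tau> (Suc j) \<le> \<tau> i"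
        using ij mono[of "Suc i" j] mono[of "Suc j" i] by (cases "i < j") auto
      ultimately show "(\<integral>z. (?g (\<tau> (Suc i)) z - ?g (\<tau> i) z) * (?g (\<tau> (Suc j)) z - ?g (\<tau> j) z) \<partial>?H) = 0"
        using inner[of "\<tau> i" "\<tau> (Suc i)" "\<tau> j" "\<tau> (Suc j)"] nonneg ij by (auto simp: min_def)
    qed simp
  qed
  have normal: "distributed (completion P) lborel (\<lambda>\<omega>. B s \<omega> - B r \<omega>) (normal_density 0 (sqrt (s - r)))"
    if "0 \<le> r" "r < s" for r s
  proof -
    have "l2_norm ?H (\<lambda>z. ?g s z - ?g r z) = sqrt (s - r)"
      using inner[of r s r s] that by (simp add: l2_norm_def power2_eq_square min_def)
    then show ?thesis
      using white_noise_version_normal[OF P version_diff[of r s]] that by simp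
  qed
  have cont: "AE \<omega> in completion P. continuous_on {0..} (\<lambda>r. B r \<omega>)"
  proof (rule AE_continuous_at_zero)
    show B_zero: "B 0 \<omega> = 0" for \<omega>
      by (simp add: B_def)
    show "square_integrable (completion P) (B r)" if "0 \<le> r" for r
      using version[OF that] by (simp add: white_noise_version_def)
    have B_normal: "distributed (completion P) lborel (B r) (normal_density 0 (sqrt r))" if "0 < r" for r
      using normal[of 0 r] that by (simp add: B_zero)
    show mean: "expectation (B r) = 0" if "0 \<le> r" for r
    proof (cases "r = 0")
      case False
      then show ?thesis
        using that normal_distributed_expectation[OF _ B_normal] by simp
    qed (simp add: B_def[abs_def])
    show "expectation (\<lambda>\<omega>. (B r \<omega>)\<^sup>2) = r" if "0 \<le> r" for r
    proof (cases "r = 0")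
      case False
      then show ?thesis
        using that normal_distributed_variance[OF _ B_normal, of r] mean[OF that] by simp
    qed (simp add: B_def)
    show "AE \<omega> in completion P. continuous_on {0<..} (\<lambda>r. B r \<omega>)"
      using assms(4)
    proof eventually_elim
      fix \<omega> assume u: "continuous_on {0<..} (\<lambda>c. u c \<omega>)"
      have "continuous_on {0<..} (\<lambda>r. 2 / t * u (1 / r) \<omega>)"
        by (intro continuous_intros continuous_on_compose2[OF u]) auto
      then show "continuous_on {0<..} (\<lambda>r. B r \<omega>)"
        by (rule continuous_on_eq) (simp add: B_def)
    qed
  qed (fact indep)
  have "brownian_motion (completion P) B"
    unfolding brownian_motion_def
    using version indep normal cont prob_space_axioms
    by (auto simp: white_noise_version_def square_integrable_def B_def)
  then show ?thesis
    by (simp add: B_def[abs_def])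
qed

end
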